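(* Let $p>2$. Then $f_p'(r)>0$ for all $r\in(0,\infty)$.
   Context: For $p>2$, $$X_p=\Big\{f\in W^{1,p}_{\mathrm{loc}}(0,\infty):\ \int_0^\infty\big(|f'|^2+\tfrac{f^2}{r^2}\big)^{p/2}\,r\,dr<\infty\Big\}$$ (real-valued functions; every $f\in X_p$ has a continuous representative on $[0,\infty)$ with $f(0)=0$), and $$I_p(f)=\int_0^\infty\Big\{\Big[(f')^2+\frac{f^2}{r^2}\Big]^{p/2}+\frac12(1-f^2)^2\Big\}\,r\,dr.$$ $f_p$ denotes the unique non-negative minimizer of $I_p$ over $X_p$; it is of class $C^\infty$ on $(0,\infty)$. *)

theory Defs
  imports "HOL-Analysis.Analysis"
begin

(* Meant for open S: there the iterated deriv is a local notion. *)
definition smooth_on :: "real set \<Rightarrow> (real \<Rightarrow> real) \<Rightarrow> bool" where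
  "smooth_on S f \<longleftrightarrow> (\<forall>n. (deriv ^^ n) f differentiable_on S)"

definition test_fun :: "(real \<Rightarrow> real) \<Rightarrow> bool" where
  "test_fun \<phi> \<longleftrightarrow> smooth_on UNIV \<phi> \<and> compact (closure {x. \<phi> x \<noteq> 0})
     \<and> closure {x. \<phi> x \<noteq> 0} \<subseteq> {0<..}"

(* Elements of function spaces over (0, \<infinity>) are represented by functions on the
   real line; their values outside (0, \<infinity>) play no role. *)
definition Lloc :: "real \<Rightarrow> (real \<Rightarrow> real) set" where
  "Lloc p = {f. set_borel_measurable lebesgue {0<..} f \<and>
     (\<forall>K. compact K \<and> K \<subseteq> {0<..} \<longrightarrow> set_integrable lebesgue K (\<lambda>x. \<bar>f x\<bar> powr p))}"

definition has_weak_deriv :: "(real \<Rightarrow> real) \<Rightarrow> (real \<Rightarrow> real) \<Rightarrow> bool" where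
  "has_weak_deriv f g \<longleftrightarrow> f \<in> Lloc 1 \<and> g \<in> Lloc 1 \<and>
     (\<forall>\<phi>. test_fun \<phi> \<longrightarrow>
        (LINT x:{0<..}|lebesgue. f x * deriv \<phi> x) = - (LINT x:{0<..}|lebesgue. g x * \<phi> x))"

(* Weak derivatives are unique only up to null sets of (0, \<infinity>); the choice does not
   affect the integrals below. *)
definition weak_deriv :: "(real \<Rightarrow> real) \<Rightarrow> real \<Rightarrow> real" where
  "weak_deriv f = (SOME g. has_weak_deriv f g)"

definition W1loc :: "real \<Rightarrow> (real \<Rightarrow> real) set" where
  "W1loc p = {f \<in> Lloc p. \<exists>g \<in> Lloc p. has_weak_deriv f g}"

definition Xp :: "real \<Rightarrow> (real \<Rightarrow> real) set" where
  "Xp p = {f \<in> W1loc p.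
     (\<integral>\<^sup>+r\<in>{0<..}. ennreal ((\<bar>weak_deriv f r\<bar>\<^sup>2 + (f r)\<^sup>2 / r\<^sup>2) powr (p / 2) * r) \<partial>lebesgue) < \<infinity>}"

(* Extended-valued: membership in Xp does not make the potential term integrable. *)
definition Ip :: "real \<Rightarrow> (real \<Rightarrow> real) \<Rightarrow> ennreal" where
  "Ip p f = (\<integral>\<^sup>+r\<in>{0<..}. ennreal
     ((((weak_deriv f r)\<^sup>2 + (f r)\<^sup>2 / r\<^sup>2) powr (p / 2) + 1 / 2 * (1 - (f r)\<^sup>2)\<^sup>2) * r) \<partial>lebesgue)"

definition minimizer :: "real \<Rightarrow> (real \<Rightarrow> real) \<Rightarrow> bool" where
  "minimizer p f \<longleftrightarrow> f \<in> Xp p \<and> (\<forall>g \<in> Xp p. Ip p f \<le> Ip p g)"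

end

theory Submission
  imports Defs
begin

text \<open>
  The Euler--Lagrange equation of the energy is $(r G f')' = (f / r) D$ with
  $G = (f'^2 + f^2/r^2)^{(p-2)/2}$ and $D = G - (2/p) r^2 (1 - f^2)$. Since $f$ is smooth but $G$ need
  not be where $f = f' = 0$, it is obtained in this divergence form by the du Bois-Reymond argument;
  $W = r G f'$ then is differentiable everywhere and has the sign of $f'$.

  If $f$ vanishes at a point, then $D < 0$ nearby, so $W$ decreases through $0$ and $f$ vanishes in a
  neighbourhood; by connectedness $f = 0$, which has infinite energy. Hence $f > 0$.
  If $f'(a) < 0$, then $f$ has a maximum at some $r_1 < a$, where $D \<le> 0$ and so $f(r_1) < 1$. Finite
  energy forces $f$ to exceed $f(r_1)$ later on, hence there is a minimum at some $r_2 > r_1$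
  with $f(r_2) < f(r_1)$, where $D \<ge> 0$. But $G = (f/r)^{p-2}$ at critical points, so
  $D(r_2) < D(r_1)$ because $p > 2$: a contradiction.
  Finally, at a critical point $a$ with $D(a) = 0$ one has $D'(a) < 0$, so in every case $f'$ becomes negative
  next to a critical point.
\<close>

section \<open>Smooth cut-off functions\<close>

text \<open>Two obstacles precede the Euler--Lagrange equation. The energy is written with
  \<open>weak_deriv\<close>, a choice among functions that agree almost everywhere, so the energy of
  a concrete competitor is known only once weak derivatives are unique; this takes enough test
  functions, hence the explicit smooth cut-offs. Secondly, the test function of the du Bois-Reymond
  argument is built from W, which is a priori only continuous. That function is therefore just C1
  and, extended by zero, may have kinks at the ends of its interval, so the competitors are
  continuous and piecewise C1 rather than smooth.

  The energy may be infinite, and then comparing energies says nothing; an explicit competitor shows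
  that the minimum is finite. Its energy converges because p > 2. The same condition makes the
  density C1 and G continuous where f = f' = 0, the exponents being p/2 > 1 and p/2 - 1 > 0. The
  factor 2/p is what remains of the potential term when the first variation is divided by p.\<close>

definition flat :: "nat \<Rightarrow> real \<Rightarrow> real" where
  "flat k x = (if x > 0 then exp (- 1 / x) / x ^ k else 0)"

lemma flat_nonpos [simp]: "x \<le> 0 \<Longrightarrow> flat k x = 0"
  by (simp add: flat_def)

lemma tendsto_flat_at_right: "(flat k \<longlongrightarrow> 0) (at_right 0)"
proof -
  have "((\<lambda>y::real. y ^ k / exp y) \<longlongrightarrow> 0) at_top"
    by (rule tendsto_power_div_exp_0)
  then have "((\<lambda>x::real. inverse x ^ k / exp (inverse x)) \<longlongrightarrow> 0) (at_right 0)"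
    by (rule filterlim_compose[OF _ filterlim_inverse_at_top_right])
  moreover have "\<forall>\<^sub>F x in at_right 0. inverse x ^ k / exp (inverse x) = flat k x"
    by (auto simp: flat_def eventually_at_filter exp_minus field_simps)
  ultimately show ?thesis
    by (rule Lim_transform_eventually)
qed

text \<open>The powers in \<open>flat\<close> close the family, up to linear combinations, under
  differentiation. At 0 the right difference quotient of \<open>flat k\<close> is
  \<open>flat (Suc k)\<close>, which tends to 0.\<close>

lemma DERIV_flat: "(flat k has_real_derivative flat (k + 2) x - real k * flat (k + 1) x) (at x)"
proof (cases x "0::real" rule: linorder_cases)
  case less
  have "((\<lambda>_. 0) has_real_derivative 0) (at x)" by simp
  then have "(flat k has_real_derivative 0) (at x)"
    by (rule has_field_derivative_transform_within_open[where S = "{..<0}"]) (use less in auto)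
  then show ?thesis using less by simp
next
  case equal
  have "((\<lambda>h. (flat k h - flat k 0) / (h - 0)) \<longlongrightarrow> 0) (at_right 0)"
    by (rule Lim_transform_eventually[OF tendsto_flat_at_right[of "Suc k"]])
       (auto simp: flat_def eventually_at_filter field_simps)
  moreover have "((\<lambda>h. (flat k h - flat k 0) / (h - 0)) \<longlongrightarrow> 0) (at_left 0)"
    by (rule Lim_transform_eventually[OF tendsto_const]) (auto simp: eventually_at_filter)
  ultimately have "((\<lambda>h. (flat k h - flat k 0) / (h - 0)) \<longlongrightarrow> 0) (at 0)"
    by (simp add: filterlim_split_at)
  then show ?thesis
    using equal by (simp add: has_field_derivative_iff)
next
  case greater
  have "((\<lambda>x. exp (- 1 / x) / x ^ k) has_real_derivative
      flat (k + 2) x - real k * flat (k + 1) x) (at x)"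
  proof (cases k)
    case 0
    then show ?thesis
      using greater by (auto intro!: derivative_eq_intros simp: flat_def field_simps power2_eq_square)
  next
    case (Suc j)
    then show ?thesis
      using greater
      by (auto intro!: derivative_eq_intros simp: flat_def field_simps power2_eq_square)
         (metis One_nat_def power_eq_if)
  qed
  then show ?thesis
    by (rule has_field_derivative_transform_within_open[where S = "{0<..}"])
       (use greater in \<open>auto simp: flat_def\<close>)
qed

text \<open>A class closed under differentiation serves as induction invariant, so no formula for
  the iterated derivatives is needed.\<close>

lemma smooth_onI_closed:
  assumes "S f"
    and "\<And>f. S f \<Longrightarrow> \<exists>g. S g \<and> (\<forall>x. (f has_real_derivative g x) (at x))"
  shows "smooth_on UNIV f"
proof -
  have deriv: "S (deriv h) \<and> h differentiable_on UNIV" if "S h" for h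
  proof -
    obtain g where g: "S g" "\<And>x. (h has_real_derivative g x) (at x)"
      using assms(2)[OF \<open>S h\<close>] by blast
    then have "deriv h = g"
      by (intro ext DERIV_imp_deriv) auto
    then show ?thesis
      using g by (auto simp: differentiable_on_def real_differentiable_def intro: has_field_derivative_at_within)
  qed
  have "S ((deriv ^^ n) f)" for n
    by (induction n) (use assms(1) deriv in auto)
  then show ?thesis
    using deriv by (auto simp: smooth_on_def)
qed

text \<open>The invariant class for \<open>bump\<close>. Signs and chain-rule factors are absorbed
  in \<open>m\<close>, so closure under sums is enough for the product rule.\<close>

inductive flat_span :: "real \<Rightarrow> real \<Rightarrow> real \<Rightarrow> (real \<Rightarrow> real) \<Rightarrow> bool" for c a b where
  base: "flat_span c a b (\<lambda>x. m * flat i (c * (x - a)) * flat j (c * (b - x)))"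
| add: "flat_span c a b f \<Longrightarrow> flat_span c a b g \<Longrightarrow> flat_span c a b (\<lambda>x. f x + g x)"

lemma flat_span_DERIV:
  assumes "flat_span c a b f"
  shows "\<exists>g. flat_span c a b g \<and> (\<forall>x. (f has_real_derivative g x) (at x))"
  using assms
proof induction
  case (base m i j)
  let ?B = "\<lambda>m i j x. m * flat i (c * (x - a)) * flat j (c * (b - x))"
  let ?g = "\<lambda>x. (?B (m * c) (i + 2) j x + ?B (- m * c * i) (i + 1) j x)
    + (?B (- m * c) i (j + 2) x + ?B (m * c * j) i (j + 1) x)"
  have "flat_span c a b ?g"
    by (intro flat_span.intros)
  moreover have "(?B m i j has_real_derivative ?g x) (at x)" for x
  proof -
    have 1: "((\<lambda>x. flat i (c * (x - a))) has_real_derivative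
        (flat (i + 2) (c * (x - a)) - real i * flat (i + 1) (c * (x - a))) * c) (at x)"
      by (rule DERIV_chain2[OF DERIV_flat]) (auto intro!: derivative_eq_intros)
    have 2: "((\<lambda>x. flat j (c * (b - x))) has_real_derivative
        (flat (j + 2) (c * (b - x)) - real j * flat (j + 1) (c * (b - x))) * (- c)) (at x)"
      by (rule DERIV_chain2[OF DERIV_flat]) (auto intro!: derivative_eq_intros)
    show ?thesis
      by (rule DERIV_cong[OF DERIV_mult[OF DERIV_cmult[OF 1, of m] 2]]) (simp add: algebra_simps)
  qed
  ultimately show ?case by blast
next
  case (add f g)
  then obtain f' g' where "flat_span c a b f'" "\<forall>x. (f has_real_derivative f' x) (at x)"
    "flat_span c a b g'" "\<forall>x. (g has_real_derivative g' x) (at x)" by blast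
  then have "flat_span c a b (\<lambda>x. f' x + g' x)"
    "\<forall>x. ((\<lambda>x. f x + g x) has_real_derivative f' x + g' x) (at x)"
    by (auto intro: flat_span.add DERIV_add)
  then show ?case by blast
qed

text \<open>The factor \<open>Suc n\<close> sends both exponents to 0 inside the interval, so the
  functions increase towards its indicator; this replaces mollification.\<close>

definition bump :: "real \<Rightarrow> real \<Rightarrow> nat \<Rightarrow> real \<Rightarrow> real" where
  "bump a b n x = flat 0 (real (Suc n) * (x - a)) * flat 0 (real (Suc n) * (b - x))"

lemma bump_eq:
  "bump a b n x = (if a < x \<and> x < b
     then exp (- 1 / (real (Suc n) * (x - a))) * exp (- 1 / (real (Suc n) * (b - x))) else 0)"
  by (simp add: bump_def flat_def zero_less_mult_iff del: of_nat_Suc)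

lemma test_fun_bump:
  assumes "0 < a"
  shows "test_fun (bump a b n)"
proof -
  have "flat_span (real (Suc n)) a b (\<lambda>x. 1 * flat 0 (real (Suc n) * (x - a)) * flat 0 (real (Suc n) * (b - x)))"
    by (rule flat_span.base)
  then have "flat_span (real (Suc n)) a b (bump a b n)"
    by (simp add: bump_def[abs_def])
  then have "smooth_on UNIV (bump a b n)"
    by (rule smooth_onI_closed[where S = "flat_span (real (Suc n)) a b"]) (rule flat_span_DERIV)
  moreover have sub: "closure {x. bump a b n x \<noteq> 0} \<subseteq> {a..b}"
    by (rule closure_minimal) (auto simp: bump_eq split: if_splits)
  moreover have "compact (closure {x. bump a b n x \<noteq> 0})"
    using sub bounded_subset[of "{a..b}"] by (simp add: compact_eq_bounded_closed)
  ultimately show ?thesis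
    using assms by (force simp: test_fun_def)
qed

lemma abs_bump_le: "\<bar>bump a b n x\<bar> \<le> indicator {a<..<b} x"
  by (auto simp: bump_eq indicator_def abs_mult intro!: mult_le_one)

text \<open>\<open>bump a b n\<close> is the \<open>(n + 1)\<close>-th root of \<open>bump a b 0\<close>.\<close>
lemma bump_LIMSEQ: "(\<lambda>n. bump a b n x) \<longlonglongrightarrow> indicator {a<..<b} x"
proof (cases "a < x \<and> x < b")
  case True
  have "(\<lambda>n. exp (- 1 / (real (Suc n) * d))) \<longlonglongrightarrow> 1" for d
  proof -
    have "(\<lambda>n. exp ((- 1 / d) * inverse (real (Suc n)))) \<longlonglongrightarrow> exp ((- 1 / d) * 0)"
      by (intro tendsto_intros LIMSEQ_inverse_real_of_nat)
    then show ?thesis by (simp add: field_simps)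
  qed
  from tendsto_mult[OF this this] show ?thesis
    using True by (simp add: bump_eq)
next
  case False
  then have "bump a b n x = 0" for n by (auto simp: bump_eq)
  then show ?thesis using False by (auto simp: indicator_def)
qed

section \<open>Uniqueness of weak derivatives\<close>

text \<open>A Dynkin argument: open intervals form an intersection-stable generator of the Borel
  sets, and the sets over which \<open>v\<close> integrates to 0 are closed under complements, by
  \<open>total\<close>, and under disjoint unions.\<close>

lemma AE_zero_if_integral_intervals_zero:
  fixes v :: "real \<Rightarrow> real"
  assumes v: "integrable lborel v"
    and total: "integral\<^sup>L lborel v = 0"
    and intervals: "\<And>a b. (\<integral>x. indicator {a<..<b} x * v x \<partial>lborel) = 0"
  shows "AE x in lborel. v x = 0"
proof -
  let ?G = "range (\<lambda>(a, b). box a (b::real))"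
  have sets: "sets borel = sigma_sets UNIV ?G"
    by (subst borel_eq_box) (simp add: sets_measure_of)
  have int: "integrable lborel (\<lambda>x. indicator A x * v x)" if "A \<in> sets borel" for A
    using integrable_mult_indicator[OF _ v, of A] that by simp
  have zero: "(\<integral>x. indicator A x * v x \<partial>lborel) = 0" if "A \<in> sigma_sets UNIV ?G" for A
  proof -
    have "Int_stable ?G"
      by (force simp: Int_stable_def Int_interval box_real)
    moreover have "?G \<subseteq> Pow UNIV" by simp
    ultimately show ?thesis
      using that
    proof (induction rule: sigma_sets_induct_disjoint)
      case (basic A)
      then show ?case using intervals by auto
    next
      case empty
      then show ?case by simp
    next
      case (compl A)
      then have A: "A \<in> sets borel" by (simp add: sets)
      have "(\<integral>x. indicator (UNIV - A) x * v x \<partial>lborel) = (\<integral>x. v x - indicator A x * v x \<partial>lborel)"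
        by (intro Bochner_Integration.integral_cong) (auto simp: indicator_def)
      then show ?case
        using compl A by (simp add: v int total)
    next
      case (union A)
      then have A: "A i \<in> sets borel" for i by (auto simp: sets)
      then have "(LINT x:(\<Union>i. A i)|lborel. v x) = (\<Sum>i. LINT x:A i|lborel. v x)"
        using union.hyps int[of "\<Union>i. A i"]
        by (intro lebesgue_integral_countable_add)
           (auto simp: disjoint_family_on_def set_integrable_def)
      then show ?case
        using union by (simp add: set_lebesgue_integral_def)
    qed
  qed
  have "AE x in lborel. v x = (\<lambda>_. 0) x"
  proof (rule density_unique_real[OF v])
    show "set_lebesgue_integral lborel A v = set_lebesgue_integral lborel A (\<lambda>_. 0)"
      if "A \<in> sets lborel" for A
      using zero that by (simp add: sets set_lebesgue_integral_def)
  qed simp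
  then show ?thesis by simp
qed

lemma Lloc_measurable:
  assumes "f \<in> Lloc p" "A \<subseteq> {0<..}" "A \<in> sets lebesgue"
  shows "set_borel_measurable lebesgue A f"
  using assms set_borel_measurable_subset[of lebesgue "{0<..}" f A] by (auto simp: Lloc_def)

lemma Lloc_1_set_integrable:
  assumes "f \<in> Lloc 1" "compact K" "K \<subseteq> {0<..}"
  shows "set_integrable lebesgue K f"
proof -
  have "set_integrable lebesgue K (\<lambda>x. \<bar>f x\<bar> powr 1)"
    using assms by (auto simp: Lloc_def)
  moreover have "set_borel_measurable lebesgue K f"
    using assms by (intro Lloc_measurable) (auto intro: lmeasurable_compact fmeasurableD)
  ultimately show ?thesis
    unfolding set_integrable_def set_borel_measurable_def
    by (rule Bochner_Integration.integrable_bound) (auto simp: indicator_def)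
qed

text \<open>The bumps are bounded by 1 and converge to indicators of open intervals, so dominated
  convergence makes \<open>u\<close> integrate to 0 over every interval with positive left
  end.\<close>

lemma fundamental_lemma:
  assumes loc: "\<And>K. compact K \<Longrightarrow> K \<subseteq> {0<..} \<Longrightarrow> set_integrable lebesgue K u"
    and orth: "\<And>\<phi>. test_fun \<phi> \<Longrightarrow> (LINT x:{0<..}|lebesgue. u x * \<phi> x) = 0"
  shows "AE x in lebesgue. x > 0 \<longrightarrow> u x = 0"
proof -
  have open_zero: "(\<integral>x. indicator {a<..<b} x * u x \<partial>lebesgue) = 0" if "0 < a" for a b
  proof -
    have int: "integrable lebesgue (\<lambda>x. indicator {a..b} x * u x)"
      using loc[of "{a..b}"] that by (simp add: set_integrable_def subset_iff)
    have eq: "indicator {0<..} x * (u x * bump a b n x) = indicator {a..b} x * u x * bump a b n x" for x n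
      using that by (auto simp: bump_eq indicator_def)
    have meas [measurable]: "bump a b n \<in> borel_measurable borel" for n
      unfolding bump_eq[abs_def] by measurable
    have "(\<lambda>n. \<integral>x. indicator {a..b} x * u x * bump a b n x \<partial>lebesgue)
        \<longlonglongrightarrow> (\<integral>x. indicator {a..b} x * u x * indicator {a<..<b} x \<partial>lebesgue)"
    proof (rule integral_dominated_convergence[where w = "\<lambda>x. \<bar>indicator {a..b} x * u x\<bar>"])
      have U: "(\<lambda>x. indicator {a..b} x * u x) \<in> borel_measurable lebesgue"
        using int by (rule borel_measurable_integrable)
      show "(\<lambda>x. indicator {a..b} x * u x * indicator {a<..<b} x) \<in> borel_measurable lebesgue"
        by (rule borel_measurable_times[OF U]) (rule borel_measurable_indicator, simp)
      have "bump a b n \<in> borel_measurable lebesgue" for n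
        using meas by (metis measurable_completion measurable_lborel2)
      then show "(\<lambda>x. indicator {a..b} x * u x * bump a b n x) \<in> borel_measurable lebesgue" for n
        by (rule borel_measurable_times[OF U])
      show "integrable lebesgue (\<lambda>x. \<bar>indicator {a..b} x * u x\<bar>)"
        using int by simp
      show "AE x in lebesgue. (\<lambda>n. indicator {a..b} x * u x * bump a b n x)
          \<longlonglongrightarrow> indicator {a..b} x * u x * indicator {a<..<b} x"
        by (intro AE_I2 tendsto_intros bump_LIMSEQ)
      have "\<bar>bump a b n x\<bar> \<le> 1" for n x
        using abs_bump_le[of a b n x] by (rule order_trans) (simp add: indicator_def)
      then show "AE x in lebesgue. norm (indicator {a..b} x * u x * bump a b n x)
          \<le> \<bar>indicator {a..b} x * u x\<bar>" for n
        by (auto simp: abs_mult intro!: AE_I2 mult_left_le)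
    qed
    moreover have "(\<integral>x. indicator {a..b} x * u x * bump a b n x \<partial>lebesgue) = 0" for n
      using orth[OF test_fun_bump[OF that, of b n]] by (simp add: set_lebesgue_integral_def eq)
    ultimately have "(\<integral>x. indicator {a..b} x * u x * indicator {a<..<b} x \<partial>lebesgue) = 0"
      by (simp add: LIMSEQ_const_iff)
    moreover have "(\<lambda>x. indicator {a..b} x * u x * indicator {a<..<b} x) = (\<lambda>x. indicator {a<..<b} x * u x)"
      by (auto simp: indicator_def)
    ultimately show ?thesis by simp
  qed
  have ae: "AE x in lebesgue. x \<in> {\<alpha><..<\<beta>} \<longrightarrow> u x = 0" if "0 < \<alpha>" for \<alpha> \<beta>
  proof -
    let ?v = "\<lambda>x. indicator {\<alpha><..<\<beta>} x * u x"
    have "set_integrable lebesgue {\<alpha>..\<beta>} u"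
      using that by (intro loc) auto
    then have int: "integrable lebesgue ?v"
      using set_integrable_subset[of lebesgue "{\<alpha>..\<beta>}" u "{\<alpha><..<\<beta>}"]
      by (simp add: set_integrable_def subset_iff)
    \<comment> \<open>The Dynkin argument runs over Borel sets and \<open>lborel\<close>, so the
      Lebesgue measurable cut-off of \<open>u\<close> is replaced by a Borel representative.\<close>
    then obtain w where w [measurable]: "w \<in> borel_measurable lborel" and vw: "AE x in lborel. ?v x = w x"
      using completion_ex_borel_measurable_real[of ?v lborel] by auto
    have vw': "AE x in lebesgue. ?v x = w x"
      using vw by (rule AE_completion)
    have wl: "w \<in> borel_measurable lebesgue"
      using w by (rule measurable_completion)
    have "integrable lebesgue w"
      using int vw' wl by (subst integrable_cong_AE[symmetric]) auto
    then have w_int: "integrable lborel w"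
      by (simp add: integrable_completion)
    have [measurable]: "?v \<in> borel_measurable lebesgue"
      using int by auto
    have "(\<integral>x. indicator {a<..<b} x * w x \<partial>lborel) = 0" for a b
    proof -
      have "(\<integral>x. indicator {a<..<b} x * w x \<partial>lborel) = (\<integral>x. indicator {a<..<b} x * w x \<partial>lebesgue)"
        by (rule integral_completion[symmetric]) measurable
      also have "\<dots> = (\<integral>x. indicator {a<..<b} x * ?v x \<partial>lebesgue)"
      proof (rule integral_cong_AE)
        have ind: "indicator {a<..<b} \<in> borel_measurable (lebesgue :: real measure)"
          by (rule borel_measurable_indicator) simp
        show "(\<lambda>x. indicator {a<..<b} x * w x) \<in> borel_measurable lebesgue"
          "(\<lambda>x. indicator {a<..<b} x * ?v x) \<in> borel_measurable lebesgue"
          using borel_measurable_times[OF ind wl]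
            borel_measurable_times[OF ind borel_measurable_integrable[OF int]] by auto
      qed (use vw' in auto)
      also have "\<dots> = (\<integral>x. indicator {max a \<alpha><..<min b \<beta>} x * u x \<partial>lebesgue)"
        by (intro Bochner_Integration.integral_cong) (auto simp: indicator_def)
      also have "\<dots> = 0"
        using that by (intro open_zero) auto
      finally show ?thesis .
    qed
    moreover have "integral\<^sup>L lborel w = 0"
    proof -
      have "integral\<^sup>L lborel w = integral\<^sup>L lebesgue w"
        by (rule integral_completion[symmetric]) measurable
      also have "\<dots> = integral\<^sup>L lebesgue ?v"
        using vw' wl by (intro integral_cong_AE) auto
      also have "\<dots> = 0"
        using that by (intro open_zero) auto
      finally show ?thesis .
    qed
    ultimately have "AE x in lborel. w x = 0"
      by (intro AE_zero_if_integral_intervals_zero w_int)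
    then have "AE x in lebesgue. w x = 0"
      by (rule AE_completion)
    then show ?thesis
      using vw' by eventually_elim (auto simp: indicator_def)
  qed
  \<comment> \<open>These intervals exhaust the half line, and a countable union of null sets is
    null.\<close>
  have "AE x in lebesgue. \<forall>n. x \<in> {1 / real (Suc n)<..<real n} \<longrightarrow> u x = 0"
    unfolding AE_all_countable by (intro allI ae) simp
  then show ?thesis
  proof eventually_elim
    case (elim x)
    show ?case
    proof
      assume "x > 0"
      obtain m where m: "x < real m" using reals_Archimedean2 by blast
      obtain k where k: "1 / real (Suc k) < x"
        using \<open>x > 0\<close> reals_Archimedean[of x] by (auto simp: inverse_eq_divide)
      have "1 / real (Suc (max m k)) \<le> 1 / real (Suc k)"
        by (intro divide_left_mono) auto
      then show "u x = 0"
        using elim[rule_format, of "max m k"] m k by auto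
    qed
  qed
qed

lemma has_weak_deriv_AE_unique:
  assumes "has_weak_deriv F g" "has_weak_deriv F h"
  shows "AE x in lebesgue. x > 0 \<longrightarrow> g x = h x"
proof -
  have "AE x in lebesgue. x > 0 \<longrightarrow> g x - h x = 0"
  proof (rule fundamental_lemma)
    show "set_integrable lebesgue K (\<lambda>x. g x - h x)" if "compact K" "K \<subseteq> {0<..}" for K
      using assms that by (intro set_integral_diff Lloc_1_set_integrable) (auto simp: has_weak_deriv_def)
    fix \<phi> assume \<phi>: "test_fun \<phi>"
    then have cont: "continuous_on UNIV \<phi>"
      unfolding test_fun_def smooth_on_def by (metis differentiable_imp_continuous_on funpow_0)
    let ?K = "closure {x. \<phi> x \<noteq> 0}"
    have K: "compact ?K" "?K \<subseteq> {0<..}"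
      using \<phi> by (auto simp: test_fun_def)
    then have "bounded (\<phi> ` ?K)"
      by (intro compact_imp_bounded compact_continuous_image continuous_on_subset[OF cont]) auto
    then obtain B where B: "\<And>x. x \<in> ?K \<Longrightarrow> \<bar>\<phi> x\<bar> \<le> B"
      by (auto simp: bounded_iff)
    \<comment> \<open>Splitting the integral of the difference requires each product to be
      integrable: \<phi> is bounded with compact support, and \<open>g\<close> is integrable
      there.\<close>
    have int: "set_integrable lebesgue {0<..} (\<lambda>x. g x * \<phi> x)" if "g \<in> Lloc 1" for g
    proof -
      have g: "integrable lebesgue (\<lambda>x. indicator ?K x * g x)"
        using Lloc_1_set_integrable[OF that K] by (simp add: set_integrable_def)
      have eq: "indicator {0<..} x *\<^sub>R (g x * \<phi> x) = indicator ?K x * g x * \<phi> x" for x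
        using K closure_subset[of "{x. \<phi> x \<noteq> 0}"] by (auto simp: indicator_def)
      have "\<phi> \<in> borel_measurable borel"
        using cont by (rule borel_measurable_continuous_onI)
      then have meas: "\<phi> \<in> borel_measurable lebesgue"
        by (metis measurable_completion measurable_lborel2)
      show ?thesis
        unfolding set_integrable_def eq
      proof (rule Bochner_Integration.integrable_bound[OF integrable_mult_right[OF g, of B]])
        show "(\<lambda>x. indicator ?K x * g x * \<phi> x) \<in> borel_measurable lebesgue"
          using borel_measurable_times[OF borel_measurable_integrable[OF g] meas] .
        show "AE x in lebesgue. norm (indicator ?K x * g x * \<phi> x) \<le> norm (B * (indicator ?K x * g x))"
        proof (rule AE_I2)
          fix x
          show "norm (indicator ?K x * g x * \<phi> x) \<le> norm (B * (indicator ?K x * g x))"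
            using mult_left_mono[OF B[of x], of "\<bar>g x\<bar>"] B[of x]
            by (auto simp: indicator_def abs_mult mult.commute)
        qed
      qed
    qed
    show "(LINT x:{0<..}|lebesgue. (g x - h x) * \<phi> x) = 0"
      using assms \<phi> by (simp add: has_weak_deriv_def left_diff_distrib int set_integral_diff)
  qed
  then show ?thesis by simp
qed

section \<open>Piecewise continuously differentiable functions\<close>

text \<open>A class of derivatives that admits the jumps where a perturbation is glued on. It is
  stable under sums and products and lies in every \<open>Lloc p\<close> with p \<ge> 0.\<close>

definition loc_bounded :: "(real \<Rightarrow> real) \<Rightarrow> bool" where
  "loc_bounded g \<longleftrightarrow> set_borel_measurable lebesgue {0<..} g \<and>
     (\<forall>K. compact K \<and> K \<subseteq> {0<..} \<longrightarrow> bounded (g ` K))"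

lemma loc_bounded_continuous:
  assumes "continuous_on {0<..} g"
  shows "loc_bounded g"
  unfolding loc_bounded_def
proof safe
  have "(\<lambda>x. indicator {0<..} x *\<^sub>R g x) \<in> borel_measurable lborel"
    using borel_measurable_continuous_on_indicator[OF _ assms] by simp
  then show "set_borel_measurable lebesgue {0<..} g"
    unfolding set_borel_measurable_def by (rule measurable_completion)
qed (use assms in \<open>auto intro!: compact_imp_bounded compact_continuous_image intro: continuous_on_subset\<close>)

lemma loc_bounded_mult:
  assumes "loc_bounded f" "loc_bounded g"
  shows "loc_bounded (\<lambda>x. f x * g x)"
  unfolding loc_bounded_def
proof safe
  have "(\<lambda>x. (indicator {0<..} x *\<^sub>R f x) * (indicator {0<..} x *\<^sub>R g x)) \<in> borel_measurable lebesgue"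
    using assms by (intro borel_measurable_times) (auto simp: loc_bounded_def set_borel_measurable_def)
  moreover have "(\<lambda>x. (indicator {0<..} x *\<^sub>R f x) * (indicator {0<..} x *\<^sub>R g x))
      = (\<lambda>x. indicator {0<..} x *\<^sub>R (f x * g x))"
    by (auto simp: indicator_def)
  ultimately show "set_borel_measurable lebesgue {0<..} (\<lambda>x. f x * g x)"
    by (simp add: set_borel_measurable_def)
  fix K :: "real set" assume "compact K" "K \<subseteq> {0<..}"
  then obtain B C where B: "\<And>x. x \<in> K \<Longrightarrow> \<bar>f x\<bar> \<le> B" and C: "\<And>x. x \<in> K \<Longrightarrow> \<bar>g x\<bar> \<le> C"
    using assms by (fastforce simp: loc_bounded_def bounded_iff)
  have "\<bar>f x * g x\<bar> \<le> B * C" if "x \<in> K" for x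
    unfolding abs_mult using B[OF that] C[OF that] by (intro mult_mono) auto
  then show "bounded ((\<lambda>x. f x * g x) ` K)"
    by (auto simp: bounded_iff)
qed

lemma loc_bounded_set_integrable:
  assumes "loc_bounded g" "compact K" "K \<subseteq> {0<..}"
  shows "set_integrable lebesgue K g"
proof -
  obtain B where B: "\<And>x. x \<in> K \<Longrightarrow> \<bar>g x\<bar> \<le> B"
    using assms by (fastforce simp: loc_bounded_def bounded_iff)
  have "K \<in> lmeasurable" using assms by (simp add: lmeasurable_compact)
  then have "integrable lebesgue (\<lambda>x. indicator K x *\<^sub>R (indicator {0<..} x *\<^sub>R g x))"
    using assms B
    by (intro integrableI_bounded_set_indicator[where B = B])
       (auto simp: loc_bounded_def set_borel_measurable_def fmeasurable_def indicator_def)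
  moreover have "(\<lambda>x. indicator K x *\<^sub>R (indicator {0<..} x *\<^sub>R g x)) = (\<lambda>x. indicator K x *\<^sub>R g x)"
    using assms by (auto simp: indicator_def fun_eq_iff)
  ultimately show ?thesis by (simp add: set_integrable_def)
qed

lemma loc_bounded_in_Lloc:
  assumes "loc_bounded g" "0 \<le> p"
  shows "g \<in> Lloc p"
proof -
  have "loc_bounded (\<lambda>x. \<bar>g x\<bar> powr p)"
    unfolding loc_bounded_def
  proof safe
    have m: "(\<lambda>x. indicator {0<..} x *\<^sub>R g x) \<in> borel_measurable lebesgue"
      using assms by (simp add: loc_bounded_def set_borel_measurable_def)
    have "(\<lambda>x. indicator {0<..} x *\<^sub>R \<bar>indicator {0<..} x *\<^sub>R g x\<bar> powr p) \<in> borel_measurable lebesgue"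
      by (intro borel_measurable_scaleR[OF _ powr_real_measurable[OF borel_measurable_abs[OF m]]]
          borel_measurable_indicator) simp_all
    moreover have "(\<lambda>x. indicator {0<..} x *\<^sub>R \<bar>indicator {0<..} x *\<^sub>R g x\<bar> powr p)
        = (\<lambda>x. indicator {0<..} x *\<^sub>R \<bar>g x\<bar> powr p)"
      by (auto simp: indicator_def)
    ultimately show "set_borel_measurable lebesgue {0<..} (\<lambda>x. \<bar>g x\<bar> powr p)"
      by (simp add: set_borel_measurable_def)
    fix K :: "real set" assume "compact K" "K \<subseteq> {0<..}"
    then obtain B where B: "\<And>x. x \<in> K \<Longrightarrow> \<bar>g x\<bar> \<le> B"
      using assms by (fastforce simp: loc_bounded_def bounded_iff)
    show "bounded ((\<lambda>x. \<bar>g x\<bar> powr p) ` K)"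
      using B \<open>0 \<le> p\<close> by (auto simp: bounded_iff intro!: exI[of _ "B powr p"] powr_mono2)
  qed
  then show ?thesis
    using assms loc_bounded_set_integrable by (auto simp: Lloc_def loc_bounded_def)
qed

text \<open>Continuity of \<open>F\<close> across the exceptional points excludes jumps, so the
  pointwise derivative is also the weak one.\<close>

definition pw_C1 :: "(real \<Rightarrow> real) \<Rightarrow> (real \<Rightarrow> real) \<Rightarrow> bool" where
  "pw_C1 F g \<longleftrightarrow> continuous_on {0<..} F \<and> loc_bounded g \<and>
     (\<exists>S. finite S \<and> (\<forall>x>0. x \<notin> S \<longrightarrow> (F has_real_derivative g x) (at x)))"

text \<open>Integration by parts on an interval with the support of \<phi> in its interior: the
  boundary terms vanish, and the fundamental theorem tolerates finitely many exceptional points of a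
  continuous function.\<close>

lemma pw_C1_has_weak_deriv:
  assumes "pw_C1 F g"
  shows "has_weak_deriv F g"
  unfolding has_weak_deriv_def
proof (intro conjI allI impI)
  obtain S where S: "finite S" "\<And>x. x > 0 \<Longrightarrow> x \<notin> S \<Longrightarrow> (F has_real_derivative g x) (at x)"
    using assms by (auto simp: pw_C1_def)
  have F: "continuous_on {0<..} F" "loc_bounded F" and g: "loc_bounded g"
    using assms by (auto simp: pw_C1_def loc_bounded_continuous)
  show "F \<in> Lloc 1" "g \<in> Lloc 1"
    using F g by (auto intro: loc_bounded_in_Lloc)
  fix \<phi> assume \<phi>: "test_fun \<phi>"
  then have *: "\<phi> differentiable_on UNIV" "deriv \<phi> differentiable_on UNIV"
    unfolding test_fun_def smooth_on_def by (metis funpow_0, metis funpow_0 funpow_simps_right(2) comp_apply funpow.simps(2))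
  then have "continuous_on UNIV \<phi>" "continuous_on UNIV (deriv \<phi>)"
    by (simp_all add: differentiable_imp_continuous_on)
  with * have d\<phi>: "(\<phi> has_real_derivative deriv \<phi> x) (at x)"
    and c\<phi>: "continuous_on A \<phi>" and c\<phi>': "continuous_on A (deriv \<phi>)" for x A
    by (auto simp: differentiable_on_def DERIV_deriv_iff_real_differentiable
        intro: continuous_on_subset)
  define K where "K = closure {x. \<phi> x \<noteq> 0}"
  have K: "compact K" "K \<subseteq> {0<..}"
    using \<phi> by (auto simp: test_fun_def K_def)
  obtain a b where ab: "0 < a" "a < b" "K \<subseteq> {a<..<b}"
  proof (cases "K = {}")
    case True
    \<comment> \<open>An empty support imposes no condition on the interval.\<close>
    then show ?thesis using that[of 1 2] by auto
  next
    case False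
    obtain k where k: "k \<in> K" "\<And>x. x \<in> K \<Longrightarrow> k \<le> x"
      using compact_attains_inf[OF K(1) False] by blast
    obtain l where l: "l \<in> K" "\<And>x. x \<in> K \<Longrightarrow> x \<le> l"
      using compact_attains_sup[OF K(1) False] by blast
    have "0 < k" "k \<le> l" using K(2) k l(2) by (auto simp: subset_iff)
    moreover have "K \<subseteq> {k / 2<..<l + 1}"
    proof
      fix x assume "x \<in> K"
      then show "x \<in> {k / 2<..<l + 1}"
        using k(2)[of x] l(2)[of x] \<open>0 < k\<close> by simp
    qed
    ultimately show ?thesis by (intro that[of "k / 2" "l + 1"]) auto
  qed
  have out: "\<phi> x = 0" "deriv \<phi> x = 0" if "x \<notin> K" for x
  proof -
    have *: "\<phi> y = 0" if "y \<in> - K" for y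
      using that closure_subset[of "{x. \<phi> x \<noteq> 0}"] by (auto simp: K_def)
    show "\<phi> x = 0" by (rule *) (use that in simp)
    have "(\<phi> has_real_derivative 0) (at x)"
    proof (rule has_field_derivative_transform_within_open)
      show "((\<lambda>_. 0) has_real_derivative 0) (at x)" by (rule DERIV_const)
      show "open (- K)" by (simp add: K_def open_Compl)
      show "x \<in> - K" using that by simp
      show "0 = \<phi> y" if "y \<in> - K" for y using *[OF that] by (rule sym)
    qed
    then show "deriv \<phi> x = 0" by (rule DERIV_imp_deriv)
  qed
  have restrict: "(LINT x:{0<..}|lebesgue. h x * \<psi> x) = integral {a..b} (\<lambda>x. h x * \<psi> x)"
    and integrable: "(\<lambda>x. h x * \<psi> x) integrable_on {a..b}"
    if "loc_bounded h" "continuous_on {0<..} \<psi>" and zero: "\<And>x. x \<notin> K \<Longrightarrow> \<psi> x = 0" for h \<psi>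
  proof -
    have int: "set_integrable lebesgue {a..b} (\<lambda>x. h x * \<psi> x)"
      using that ab by (intro loc_bounded_set_integrable loc_bounded_mult[OF _ loc_bounded_continuous]) auto
    have "\<psi> x = 0" if "x \<notin> {a..b}" for x
      using zero[of x] ab that by force
    then have "(LINT x:{0<..}|lebesgue. h x * \<psi> x) = (LINT x:{a..b}|lebesgue. h x * \<psi> x)"
      unfolding set_lebesgue_integral_def
      using ab by (intro Bochner_Integration.integral_cong) (auto simp: indicator_def)
    then show "(LINT x:{0<..}|lebesgue. h x * \<psi> x) = integral {a..b} (\<lambda>x. h x * \<psi> x)"
      using set_lebesgue_integral_eq_integral(2)[OF int] by simp
    show "(\<lambda>x. h x * \<psi> x) integrable_on {a..b}"
      using set_lebesgue_integral_eq_integral(1)[OF int] .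
  qed
  have "((\<lambda>x. F x * deriv \<phi> x + g x * \<phi> x) has_integral F b * \<phi> b - F a * \<phi> a) {a..b}"
  proof (rule fundamental_theorem_of_calculus_interior_strong[OF S(1)])
    show "continuous_on {a..b} (\<lambda>x. F x * \<phi> x)"
      using ab by (intro continuous_intros c\<phi> continuous_on_subset[OF F(1)]) auto
    fix x assume "x \<in> {a<..<b} - S"
    then have "(F has_real_derivative g x) (at x)" using S ab by auto
    from DERIV_mult[OF this d\<phi>]
    show "((\<lambda>x. F x * \<phi> x) has_vector_derivative F x * deriv \<phi> x + g x * \<phi> x) (at x)"
      by (simp add: has_real_derivative_iff_has_vector_derivative ac_simps)
  qed (use ab in auto)
  moreover have "a \<notin> K" "b \<notin> K" using ab by auto
  ultimately have "integral {a..b} (\<lambda>x. F x * deriv \<phi> x + g x * \<phi> x) = 0"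
    using out(1)[OF \<open>a \<notin> K\<close>] out(1)[OF \<open>b \<notin> K\<close>] by (auto dest!: integral_unique)
  then show "(LINT x:{0<..}|lebesgue. F x * deriv \<phi> x) = - (LINT x:{0<..}|lebesgue. g x * \<phi> x)"
    using F g out c\<phi> c\<phi>' by (simp add: restrict integrable Henstock_Kurzweil_Integration.integral_add)
qed

text \<open>This ties the function chosen by \<open>SOME\<close> to the explicit derivative, up to a
  null set that the integrals ignore.\<close>

lemma pw_C1_weak_deriv:
  assumes "pw_C1 F g"
  shows "AE x in lebesgue. x > 0 \<longrightarrow> weak_deriv F x = g x"
proof (rule has_weak_deriv_AE_unique)
  show "has_weak_deriv F g" using assms by (rule pw_C1_has_weak_deriv)
  then show "has_weak_deriv F (weak_deriv F)"
    unfolding weak_deriv_def by (rule someI[of "has_weak_deriv F"])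
qed

lemma pw_C1_Xp_iff:
  assumes "pw_C1 F g" "0 \<le> p"
  shows "F \<in> Xp p \<longleftrightarrow>
    (\<integral>\<^sup>+r\<in>{0<..}. ennreal (((g r)\<^sup>2 + (F r)\<^sup>2 / r\<^sup>2) powr (p / 2) * r) \<partial>lebesgue) < \<infinity>"
proof -
  have "F \<in> W1loc p"
    using assms pw_C1_has_weak_deriv[OF assms(1)]
    by (auto simp: W1loc_def pw_C1_def intro!: loc_bounded_in_Lloc loc_bounded_continuous)
  moreover have "(\<integral>\<^sup>+r\<in>{0<..}. ennreal ((\<bar>weak_deriv F r\<bar>\<^sup>2 + (F r)\<^sup>2 / r\<^sup>2) powr (p / 2) * r) \<partial>lebesgue)
    = (\<integral>\<^sup>+r\<in>{0<..}. ennreal (((g r)\<^sup>2 + (F r)\<^sup>2 / r\<^sup>2) powr (p / 2) * r) \<partial>lebesgue)"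
    by (intro nn_integral_cong_AE, use pw_C1_weak_deriv[OF assms(1)] in eventually_elim)
       (auto simp: indicator_def)
  ultimately show ?thesis by (simp add: Xp_def)
qed

lemma pw_C1_Ip:
  assumes "pw_C1 F g"
  shows "Ip p F = (\<integral>\<^sup>+r\<in>{0<..}. ennreal
     ((((g r)\<^sup>2 + (F r)\<^sup>2 / r\<^sup>2) powr (p / 2) + 1 / 2 * (1 - (F r)\<^sup>2)\<^sup>2) * r) \<partial>lebesgue)"
  unfolding Ip_def
  by (intro nn_integral_cong_AE, use pw_C1_weak_deriv[OF assms(1)] in eventually_elim)
     (auto simp: indicator_def)

section \<open>A competitor of finite energy\<close>

text \<open>The factor \<open>r\<close> makes the integrand explicitly integrable, and e > 1 makes
  the primitive \<open>?F\<close> vanish at infinity.\<close>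

lemma nn_integral_radial_decay:
  assumes "e > 1"
  shows "(\<integral>\<^sup>+r\<in>{0<..}. ennreal (r * (1 + r\<^sup>2) powr (- e)) \<partial>lebesgue) < \<infinity>"
proof -
  have pos: "1 + x\<^sup>2 > 0" for x :: real by (smt (verit) zero_le_power2)
  let ?F = "\<lambda>r::real. (1 + r\<^sup>2) powr (1 - e) / (2 * (1 - e))"
  have "(\<integral>\<^sup>+r. ennreal (r * (1 + r\<^sup>2) powr (- e)) * indicator {0..} r \<partial>lborel) = ennreal (0 - ?F 0)"
  proof (rule nn_integral_FTC_atLeast)
    fix x :: real assume "0 \<le> x"
    have "((\<lambda>r. (1 + r\<^sup>2) powr (1 - e)) has_real_derivative
        (1 - e) * (1 + x\<^sup>2) powr (- e) * (2 * x)) (at x)"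
    proof -
      have "((\<lambda>r::real. 1 + r\<^sup>2) has_real_derivative 2 * x) (at x)"
        by (auto intro!: derivative_eq_intros)
      from DERIV_chain[OF has_real_derivative_powr[OF pos] this, of "1 - e"]
      show ?thesis by (simp add: o_def)
    qed
    then show "(?F has_real_derivative x * (1 + x\<^sup>2) powr (- e)) (at x)"
      by (rule DERIV_cong[OF DERIV_cdivide]) (use assms in \<open>simp add: divide_simps\<close>)
  next
    have "filterlim (\<lambda>r::real. 1 + r\<^sup>2) at_top at_top"
      by (intro filterlim_tendsto_add_at_top[OF tendsto_const] filterlim_pow_at_top filterlim_ident) simp
    from tendsto_neg_powr[OF _ this, of "1 - e"] assms
    have "((\<lambda>r::real. (1 + r\<^sup>2) powr (1 - e)) \<longlongrightarrow> 0) at_top" by simp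
    from tendsto_divide[OF this tendsto_const, of "2 * (1 - e)"]
    show "(?F \<longlongrightarrow> 0) at_top" using assms by simp
  qed (auto intro!: borel_measurable_times)
  also have "\<dots> < \<infinity>"
    by (simp only: infinity_ennreal_def ennreal_less_top)
  finally have fin: "(\<integral>\<^sup>+r. ennreal (r * (1 + r\<^sup>2) powr (- e)) * indicator {0..} r \<partial>lborel) < \<infinity>" .
  have "(\<integral>\<^sup>+r\<in>{0<..}. ennreal (r * (1 + r\<^sup>2) powr (- e)) \<partial>lborel) \<le>
      (\<integral>\<^sup>+r. ennreal (r * (1 + r\<^sup>2) powr (- e)) * indicator {0..} r \<partial>lborel)"
    by (intro nn_integral_mono) (auto simp: indicator_def)
  then show ?thesis
    unfolding nn_integral_completion using fin by (rule le_less_trans)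
qed

lemma ennreal_le_Ip_density:
  "ennreal (q powr s * r) \<le> ennreal ((q powr s + 1 / 2 * (1 - z\<^sup>2)\<^sup>2) * r)" if "r > 0"
  using that by (intro ennreal_leI mult_right_mono) auto

text \<open>The potential term is non-negative, so the energy dominates the integral defining
  \<open>Xp\<close>: a competitor of finite energy is automatically admissible.\<close>

lemma Xp_if_Ip_finite:
  assumes "pw_C1 F g" "0 \<le> p" "Ip p F < \<infinity>"
  shows "F \<in> Xp p"
proof -
  have "(\<integral>\<^sup>+r\<in>{0<..}. ennreal (((g r)\<^sup>2 + (F r)\<^sup>2 / r\<^sup>2) powr (p / 2) * r) \<partial>lebesgue) \<le> Ip p F"
    unfolding pw_C1_Ip[OF assms(1)]
    by (intro nn_integral_mono) (simp add: indicator_def ennreal_le_Ip_density del: ennreal_plus)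
  then show ?thesis
    unfolding pw_C1_Xp_iff[OF assms(1,2)] using assms(3) by (rule le_less_trans)
qed

text \<open>The choice \<open>r / sqrt (1 + r\<^sup>2)\<close> is linear near 0, so
  \<open>F r / r\<close> stays bounded, and tends to 1 fast enough: both
  \<open>(F r)\<^sup>2 / r\<^sup>2\<close> and \<open>1 - (F r)\<^sup>2\<close> equal
  \<open>1 / (1 + r\<^sup>2)\<close>. The resulting decay exponents are p/2 and 2, both above
  1.\<close>

lemma exists_finite_energy:
  assumes "p > 2"
  shows "\<exists>F \<in> Xp p. Ip p F < \<infinity>"
proof -
  define F :: "real \<Rightarrow> real" where "F r = r / sqrt (1 + r\<^sup>2)" for r
  define g :: "real \<Rightarrow> real" where "g r = 1 / sqrt (1 + r\<^sup>2) ^ 3" for r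
  have pos: "1 + x\<^sup>2 > 0" for x :: real by (smt (verit) zero_le_power2)
  then have ne: "1 + x\<^sup>2 \<noteq> 0" for x :: real by (metis less_irrefl)
  have deriv: "(F has_real_derivative g x) (at x)" for x
  proof -
    define s where "s = sqrt (1 + x\<^sup>2)"
    have s: "s > 0" "s * s = 1 + x * x"
      using pos[of x] by (simp_all add: s_def power2_eq_square)
    have "((\<lambda>x::real. 1 + x\<^sup>2) has_real_derivative 2 * x) (at x)"
      by (auto intro!: derivative_eq_intros)
    from DERIV_chain[OF DERIV_real_sqrt[OF pos] this]
    have "((\<lambda>x. sqrt (1 + x\<^sup>2)) has_real_derivative x / s) (at x)"
      by (simp add: o_def s_def field_simps)
    from DERIV_divide[OF DERIV_ident this]
    have "(F has_real_derivative (1 * s - x * (x / s)) / (s * s)) (at x)"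
      using s by (simp add: F_def[abs_def] s_def)
    moreover have "(1 * s - x * (x / s)) / (s * s) = 1 / s ^ 3"
    proof -
      have "1 * s - x * (x / s) = (s * s - x * x) / s"
        using s(1) by (simp add: diff_divide_distrib)
      also have "\<dots> = 1 / s" by (simp add: s(2))
      finally show ?thesis by (simp add: power3_eq_cube mult.assoc)
    qed
    ultimately show ?thesis by (simp add: g_def s_def)
  qed
  have "continuous_on {0<..} F"
    by (rule DERIV_continuous_on) (rule has_field_derivative_at_within[OF deriv])
  moreover have "continuous_on {0<..} g"
    unfolding g_def[abs_def] by (intro continuous_intros) (simp add: ne)
  ultimately have F: "pw_C1 F g"
    unfolding pw_C1_def using deriv by (auto intro: loc_bounded_continuous finite.emptyI)
  have F2: "(F r)\<^sup>2 = r\<^sup>2 / (1 + r\<^sup>2)" and g2: "(g r)\<^sup>2 = 1 / (1 + r\<^sup>2) ^ 3" for r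
  proof -
    have "(sqrt (1 + r\<^sup>2) ^ 3)\<^sup>2 = (sqrt (1 + r\<^sup>2))\<^sup>2 ^ 3"
      by (metis power_mult mult.commute)
    then show "(F r)\<^sup>2 = r\<^sup>2 / (1 + r\<^sup>2)" "(g r)\<^sup>2 = 1 / (1 + r\<^sup>2) ^ 3"
      using pos[of r] by (simp_all add: F_def g_def power_divide)
  qed
  have bound: "(((g r)\<^sup>2 + (F r)\<^sup>2 / r\<^sup>2) powr (p / 2) + 1 / 2 * (1 - (F r)\<^sup>2)\<^sup>2) * r
      \<le> 2 powr (p / 2) * (r * (1 + r\<^sup>2) powr (- (p / 2))) + r * (1 + r\<^sup>2) powr (- 2)" if "r > 0" for r
  proof -
    have "1 / (1 + r\<^sup>2) ^ 3 \<le> 1 / (1 + r\<^sup>2)"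
    proof (rule divide_left_mono)
      show "1 + r\<^sup>2 \<le> (1 + r\<^sup>2) ^ 3"
        by (rule self_le_power) simp_all
    qed (use pos[of r] in simp_all)
    then have "(g r)\<^sup>2 + (F r)\<^sup>2 / r\<^sup>2 \<le> 2 / (1 + r\<^sup>2)"
      using that by (simp add: F2 g2)
    then have "((g r)\<^sup>2 + (F r)\<^sup>2 / r\<^sup>2) powr (p / 2) \<le> (2 / (1 + r\<^sup>2)) powr (p / 2)"
      using assms by (intro powr_mono2) auto
    also have "\<dots> = 2 powr (p / 2) * (1 + r\<^sup>2) powr (- (p / 2))"
      by (simp add: powr_divide powr_minus_divide)
    finally have 1: "((g r)\<^sup>2 + (F r)\<^sup>2 / r\<^sup>2) powr (p / 2) \<le> \<dots>" .
    have "1 - (F r)\<^sup>2 = 1 / (1 + r\<^sup>2)"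
      using ne[of r] unfolding F2 by (metis add_diff_cancel_right' diff_divide_distrib divide_self)
    then have 2: "1 / 2 * (1 - (F r)\<^sup>2)\<^sup>2 \<le> (1 + r\<^sup>2) powr (- 2)"
      using powr_realpow[OF pos[of r], of 2] pos[of r]
      by (simp add: powr_minus power_one_over inverse_eq_divide frac_le)
    have "(A * B + C) * r = A * (r * B) + r * C" for A B C :: real
      by (simp add: algebra_simps)
    then show ?thesis
      using mult_right_mono[OF add_mono[OF 1 2], of r] that by simp
  qed
  have "Ip p F \<le> (\<integral>\<^sup>+r. ennreal (2 powr (p / 2)) * (ennreal (r * (1 + r\<^sup>2) powr (- (p / 2))) * indicator {0<..} r)
      + ennreal (r * (1 + r\<^sup>2) powr (- 2)) * indicator {0<..} r \<partial>lebesgue)"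
    unfolding pw_C1_Ip[OF F]
  proof (rule nn_integral_mono)
    fix r :: real
    show "ennreal ((((g r)\<^sup>2 + (F r)\<^sup>2 / r\<^sup>2) powr (p / 2) + 1 / 2 * (1 - (F r)\<^sup>2)\<^sup>2) * r) * indicator {0<..} r
      \<le> ennreal (2 powr (p / 2)) * (ennreal (r * (1 + r\<^sup>2) powr (- (p / 2))) * indicator {0<..} r)
      + ennreal (r * (1 + r\<^sup>2) powr (- 2)) * indicator {0<..} r"
    proof (cases "r > 0")
      case True
      then show ?thesis
        using ennreal_leI[OF bound[OF True]] by (simp add: ennreal_plus ennreal_mult)
    qed simp
  qed
  also have "\<dots> = ennreal (2 powr (p / 2)) * (\<integral>\<^sup>+r\<in>{0<..}. ennreal (r * (1 + r\<^sup>2) powr (- (p / 2))) \<partial>lebesgue)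
      + (\<integral>\<^sup>+r\<in>{0<..}. ennreal (r * (1 + r\<^sup>2) powr (- 2)) \<partial>lebesgue)"
  proof -
    have "(\<lambda>r. ennreal (r * (1 + r\<^sup>2) powr (- e)) * indicator {0<..} r) \<in> borel_measurable borel" for e :: real
      by measurable
    then have m: "(\<lambda>r. ennreal (r * (1 + r\<^sup>2) powr (- e)) * indicator {0<..} r) \<in> borel_measurable lebesgue" for e :: real
      by (metis measurable_completion measurable_lborel2)
    show ?thesis
      by (subst nn_integral_add, rule borel_measurable_times_ennreal, rule borel_measurable_const,
          rule m, rule m, subst nn_integral_cmult[OF m]) (rule refl)
  qed
  also have "\<dots> < \<infinity>"
  proof -
    have fin: "(\<integral>\<^sup>+r\<in>{0<..}. ennreal (r * (1 + r\<^sup>2) powr (- (p / 2))) \<partial>lebesgue) < \<infinity>"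
      "(\<integral>\<^sup>+r\<in>{0<..}. ennreal (r * (1 + r\<^sup>2) powr (- 2)) \<partial>lebesgue) < \<infinity>"
      using assms by (intro nn_integral_radial_decay; simp)+
    show ?thesis
      unfolding infinity_ennreal_def
      by (rule ennreal_add_less_top[THEN iffD2, OF conjI],
          rule ennreal_mult_less_top[THEN iffD2]) (use fin in \<open>auto simp: infinity_ennreal_def\<close>)
  qed
  finally have "Ip p F < \<infinity>" .
  moreover from this have "F \<in> Xp p"
    by (rule Xp_if_Ip_finite[OF F, rotated]) (use assms in simp)
  ultimately show ?thesis by blast
qed

section \<open>The first variation\<close>

text \<open>At \<open>x = 0\<close> this is a two-sided derivative: \<open>x powr s = \<bar>x\<bar> powr s\<close> for negative \<open>x\<close>, as
  the logarithm is extended to an even function.\<close>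
lemma DERIV_powr_nonneg:
  fixes x s :: real
  assumes "0 \<le> x" "1 < s"
  shows "((\<lambda>x. x powr s) has_real_derivative s * x powr (s - 1)) (at x)"
proof (cases "x = 0")
  case False
  then show ?thesis
    using assms by (intro has_real_derivative_powr) simp
next
  case True
  have "((\<lambda>h::real. \<bar>h\<bar> powr (s - 1)) \<longlongrightarrow> \<bar>0\<bar> powr (s - 1)) (at 0)"
    using assms by (intro tendsto_powr' tendsto_intros) auto
  then have "((\<lambda>h::real. \<bar>h\<bar> powr (s - 1)) \<longlongrightarrow> 0) (at 0)" by simp
  then have "((\<lambda>h::real. \<bar>(h powr s - 0 powr s) / (h - 0)\<bar>) \<longlongrightarrow> 0) (at 0)"
  proof (rule Lim_transform_eventually)
    have "\<bar>h\<bar> powr (s - 1) = \<bar>(h powr s - 0 powr s) / (h - 0)\<bar>" if "h \<noteq> 0" for h :: real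
    proof -
      have "h powr s = \<bar>h\<bar> powr s"
        by (cases "h \<ge> 0") (auto simp: uminus_powr_eq)
      then show ?thesis
        using that by (simp add: abs_divide powr_diff)
    qed
    then show "\<forall>\<^sub>F h in at 0. \<bar>h\<bar> powr (s - 1) = \<bar>(h powr s - 0 powr s) / (h - 0)\<bar>"
      by (simp only: eventually_at_filter) (rule always_eventually, blast)
  qed
  then have "((\<lambda>h::real. (h powr s - 0 powr s) / (h - 0)) \<longlongrightarrow> 0) (at 0)"
    by (rule tendsto_rabs_zero_cancel)
  then show ?thesis
    using True assms by (simp add: has_field_derivative_iff)
qed

section \<open>The energy density and its directional derivative\<close>

definition energy_density :: "real \<Rightarrow> real \<Rightarrow> real \<Rightarrow> real \<Rightarrow> real" where
  "energy_density p r y z = ((z\<^sup>2 + y\<^sup>2 / r\<^sup>2) powr (p / 2) + 1 / 2 * (1 - y\<^sup>2)\<^sup>2) * r"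

lemma energy_density_nonneg: "r > 0 \<Longrightarrow> 0 \<le> energy_density p r y z"
  by (simp add: energy_density_def)

text \<open>The derivative of \<open>energy_density\<close> at \<open>(y, z)\<close> in the
  direction \<open>(\<phi>, \<psi>)\<close>.\<close>

definition energy_variation :: "real \<Rightarrow> real \<Rightarrow> real \<Rightarrow> real \<Rightarrow> real \<Rightarrow> real \<Rightarrow> real" where
  "energy_variation p r y z \<phi> \<psi> =
     (p / 2 * (z\<^sup>2 + y\<^sup>2 / r\<^sup>2) powr (p / 2 - 1) * (2 * z * \<psi> + 2 * y * \<phi> / r\<^sup>2) - 2 * y * (1 - y\<^sup>2) * \<phi>) * r"

lemma DERIV_energy_density:
  assumes "p > 2"
  shows "((\<lambda>t. energy_density p r (y + t * \<phi>) (z + t * \<psi>)) has_real_derivative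
     energy_variation p r (y + t * \<phi>) (z + t * \<psi>) \<phi> \<psi>) (at t)"
proof -
  let ?q = "\<lambda>t. (z + t * \<psi>)\<^sup>2 + (y + t * \<phi>)\<^sup>2 / r\<^sup>2"
  have q: "(?q has_real_derivative 2 * (z + t * \<psi>) * \<psi> + 2 * (y + t * \<phi>) * \<phi> / r\<^sup>2) (at t)"
    \<comment> \<open>For \<open>r = 0\<close> the quotients by \<open>r\<^sup>2\<close> are 0 by
      the convention on division.\<close>
    by (cases "r = 0") (auto intro!: derivative_eq_intros simp: field_simps)
  have "((\<lambda>t. ?q t powr (p / 2)) has_real_derivative
      p / 2 * ?q t powr (p / 2 - 1) * (2 * (z + t * \<psi>) * \<psi> + 2 * (y + t * \<phi>) * \<phi> / r\<^sup>2)) (at t)"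
    by (rule DERIV_chain2[where f = "\<lambda>x. x powr (p / 2)" and g = ?q, OF DERIV_powr_nonneg q])
       (use assms in auto)
  moreover have "((\<lambda>t. 1 / 2 * (1 - (y + t * \<phi>)\<^sup>2)\<^sup>2) has_real_derivative
      - (2 * (y + t * \<phi>) * (1 - (y + t * \<phi>)\<^sup>2) * \<phi>)) (at t)"
    by (auto intro!: derivative_eq_intros simp: field_simps power2_eq_square)
  ultimately show ?thesis
    unfolding energy_density_def energy_variation_def
    by (rule DERIV_cong[OF DERIV_cmult_right[OF DERIV_add]]) simp
qed

lemma continuous_on_energy_variation:
  assumes "p > 2" "continuous_on A r" "continuous_on A y" "continuous_on A z"
    "continuous_on A \<phi>" "continuous_on A \<psi>" "\<And>x. x \<in> A \<Longrightarrow> r x \<noteq> 0"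
  shows "continuous_on A (\<lambda>x. energy_variation p (r x) (y x) (z x) (\<phi> x) (\<psi> x))"
  unfolding energy_variation_def using assms
  by (intro continuous_intros continuous_on_powr') auto

lemma continuous_on_energy_density:
  assumes "p > 2" "continuous_on A r" "continuous_on A y" "continuous_on A z"
    "\<And>x. x \<in> A \<Longrightarrow> r x \<noteq> 0"
  shows "continuous_on A (\<lambda>x. energy_density p (r x) (y x) (z x))"
  unfolding energy_density_def using assms
  by (intro continuous_intros continuous_on_powr') auto

lemma pw_C1_Ip_density:
  assumes "pw_C1 F g"
  shows "Ip p F = (\<integral>\<^sup>+r\<in>{0<..}. ennreal (energy_density p r (F r) (g r)) \<partial>lebesgue)"
  by (simp add: pw_C1_Ip[OF assms] energy_density_def)

lemma energy_density_measurable: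
  assumes "pw_C1 F g"
  shows "(\<lambda>r. ennreal (energy_density p r (F r) (g r)) * indicator {0<..} r) \<in> borel_measurable lebesgue"
proof -
  let ?F = "\<lambda>r. indicator {0<..} r *\<^sub>R F r" and ?g = "\<lambda>r. indicator {0<..} r *\<^sub>R g r"
  have "?F \<in> borel_measurable lebesgue" "?g \<in> borel_measurable lebesgue"
    using assms loc_bounded_continuous[of F]
    by (auto simp: pw_C1_def loc_bounded_def set_borel_measurable_def)
  moreover have "(\<lambda>r::real. r) \<in> borel_measurable lebesgue"
    by (rule measurable_completion) simp
  moreover have "indicator {0<..} \<in> borel_measurable (lebesgue :: real measure)"
    by (rule borel_measurable_indicator) simp
  ultimately have "(\<lambda>r. ennreal (indicator {0<..} r * energy_density p r (?F r) (?g r))) \<in> borel_measurable lebesgue"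
    unfolding energy_density_def by measurable
  moreover have "(\<lambda>r. ennreal (indicator {0<..} r * energy_density p r (?F r) (?g r)))
      = (\<lambda>r. ennreal (energy_density p r (F r) (g r)) * indicator {0<..} r)"
    by (auto simp: indicator_def fun_eq_iff)
  ultimately show ?thesis by simp
qed

section \<open>Perturbations supported in a compact interval\<close>

lemma loc_bounded_add:
  assumes "loc_bounded f" "loc_bounded g"
  shows "loc_bounded (\<lambda>x. f x + g x)"
  unfolding loc_bounded_def
proof safe
  have "(\<lambda>x. indicator {0<..} x *\<^sub>R f x + indicator {0<..} x *\<^sub>R g x) \<in> borel_measurable lebesgue"
    using assms by (intro borel_measurable_add) (auto simp: loc_bounded_def set_borel_measurable_def)
  then show "set_borel_measurable lebesgue {0<..} (\<lambda>x. f x + g x)"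
    by (simp add: set_borel_measurable_def distrib_left)
  fix K :: "real set" assume "compact K" "K \<subseteq> {0<..}"
  then show "bounded ((\<lambda>x. f x + g x) ` K)"
    using assms by (intro bounded_plus_comp) (auto simp: loc_bounded_def)
qed

lemma loc_bounded_indicator: "loc_bounded (indicator {\<alpha>..\<beta>})"
  unfolding loc_bounded_def set_borel_measurable_def
proof safe
  show "(\<lambda>x. indicator {0<..} x *\<^sub>R indicator {\<alpha>..\<beta>} x :: real) \<in> borel_measurable lebesgue"
    by (intro borel_measurable_scaleR borel_measurable_indicator) simp_all
  fix K :: "real set"
  show "bounded (indicator {\<alpha>..\<beta>} ` K :: real set)"
    unfolding bounded_iff by (rule exI[of _ 1]) (simp add: indicator_def)
qed

lemma pw_C1_add_local:
  assumes f: "pw_C1 f f'"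
    and ab: "\<alpha> \<le> \<beta>"
    and \<phi>: "continuous_on {\<alpha>..\<beta>} \<phi>" "\<phi> \<alpha> = 0" "\<phi> \<beta> = 0"
    and \<psi>: "continuous_on {\<alpha>..\<beta>} \<psi>"
    and deriv: "\<And>r. \<alpha> < r \<Longrightarrow> r < \<beta> \<Longrightarrow> (\<phi> has_real_derivative \<psi> r) (at r)"
  shows "pw_C1 (\<lambda>r. f r + t * (\<phi> r * indicator {\<alpha>..\<beta>} r)) (\<lambda>r. f' r + t * (\<psi> r * indicator {\<alpha>..\<beta>} r))"
proof -
  \<comment> \<open>Composition with the clamp \<open>?c\<close> extends \<phi> by its end values,
    hence by 0, and keeps it continuous. For \<psi> the clamp supplies a continuous factor of the
    indicator, and the jumps at the ends remain.\<close>
  let ?c = "\<lambda>r. max \<alpha> (min \<beta> r)"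
  have clamp: "continuous_on {0<..} (\<lambda>r. h (?c r))" if "continuous_on {\<alpha>..\<beta>} h" for h :: "real \<Rightarrow> real"
    by (rule continuous_on_compose2[OF that]) (use ab in \<open>auto intro!: continuous_intros\<close>)
  have \<Phi>: "\<phi> r * indicator {\<alpha>..\<beta>} r = \<phi> (?c r)" for r
    using ab \<phi> by (auto simp: indicator_def max_def min_def)
  have \<Psi>: "\<psi> r * indicator {\<alpha>..\<beta>} r = \<psi> (?c r) * indicator {\<alpha>..\<beta>} r" for r
    by (auto simp: indicator_def max_def min_def)
  obtain S where S: "finite S" "\<And>x. x > 0 \<Longrightarrow> x \<notin> S \<Longrightarrow> (f has_real_derivative f' x) (at x)"
    using f by (auto simp: pw_C1_def)
  have d: "((\<lambda>r. \<phi> r * indicator {\<alpha>..\<beta>} r) has_real_derivative \<psi> r * indicator {\<alpha>..\<beta>} r) (at r)"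
    if "r \<noteq> \<alpha>" "r \<noteq> \<beta>" for r
  proof (cases "\<alpha> < r \<and> r < \<beta>")
    case True
    then have "(\<phi> has_real_derivative \<psi> r * indicator {\<alpha>..\<beta>} r) (at r)"
      using deriv by simp
    then show ?thesis
      by (rule has_field_derivative_transform_within_open[where S = "{\<alpha><..<\<beta>}"]) (use True in auto)
  next
    case False
    then have "((\<lambda>_. 0) has_real_derivative \<psi> r * indicator {\<alpha>..\<beta>} r) (at r)"
      using that by (auto simp: indicator_def)
    then show ?thesis
      by (rule has_field_derivative_transform_within_open[where S = "- {\<alpha>..\<beta>}"]) (use that False in auto)
  qed
  have "continuous_on {0<..} (\<lambda>r. f r + t * (\<phi> r * indicator {\<alpha>..\<beta>} r))"
    unfolding \<Phi> using f by (intro continuous_intros clamp \<phi>) (simp add: pw_C1_def)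
  moreover have "loc_bounded (\<lambda>r. f' r + t * (\<psi> r * indicator {\<alpha>..\<beta>} r))"
    using f unfolding \<Psi>
    by (intro loc_bounded_add loc_bounded_mult loc_bounded_indicator loc_bounded_continuous[OF clamp[OF \<psi>]]
        loc_bounded_continuous[OF continuous_on_const]) (simp add: pw_C1_def)
  moreover have "((\<lambda>r. f r + t * (\<phi> r * indicator {\<alpha>..\<beta>} r)) has_real_derivative
      f' r + t * (\<psi> r * indicator {\<alpha>..\<beta>} r)) (at r)" if "r > 0" "r \<notin> insert \<alpha> (insert \<beta> S)" for r
    using that by (intro DERIV_add DERIV_cmult S(2) d) auto
  ultimately show ?thesis
    unfolding pw_C1_def using S(1)
    by (intro conjI exI[of _ "insert \<alpha> (insert \<beta> S)"]) simp_all
qed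

text \<open>A perturbation changes the energy only on \<open>{\<alpha>..\<beta>}\<close>. Once the
  energy \<open>C\<close> outside is cancelled, t = 0 minimizes an ordinary integral
  \<open>J\<close> over a compact interval, which can be differentiated under the integral
  sign.\<close>

lemma first_variation:
  assumes "p > 2" and min: "minimizer p f" and f: "pw_C1 f f'" and f': "continuous_on {0<..} f'"
    and ab: "0 < \<alpha>" "\<alpha> \<le> \<beta>"
    and \<phi>: "continuous_on {\<alpha>..\<beta>} \<phi>" "\<phi> \<alpha> = 0" "\<phi> \<beta> = 0"
    and \<psi>: "continuous_on {\<alpha>..\<beta>} \<psi>"
    and deriv: "\<And>r. \<alpha> < r \<Longrightarrow> r < \<beta> \<Longrightarrow> (\<phi> has_real_derivative \<psi> r) (at r)"
  shows "integral {\<alpha>..\<beta>} (\<lambda>r. energy_variation p r (f r) (f' r) (\<phi> r) (\<psi> r)) = 0"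
proof -
  let ?F = "\<lambda>t r. f r + t * (\<phi> r * indicator {\<alpha>..\<beta>} r)"
  let ?g = "\<lambda>t r. f' r + t * (\<psi> r * indicator {\<alpha>..\<beta>} r)"
  let ?L = "\<lambda>t r. energy_density p r (f r + t * \<phi> r) (f' r + t * \<psi> r)"
  have F: "pw_C1 (?F t) (?g t)" for t
    by (rule pw_C1_add_local) fact+
  define C where "C = (\<integral>\<^sup>+r\<in>{0<..} - {\<alpha>..\<beta>}. ennreal (energy_density p r (f r) (f' r)) \<partial>lebesgue)"
  define J where "J t = integral {\<alpha>..\<beta>} (?L t)" for t
  have cf: "continuous_on {\<alpha>..\<beta>} f" "continuous_on {\<alpha>..\<beta>} f'"
    using f f' ab by (auto simp: pw_C1_def intro: continuous_on_subset)
  have cL: "continuous_on {\<alpha>..\<beta>} (?L t)" for t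
    using ab by (intro continuous_on_energy_density continuous_intros cf \<phi> \<psi> \<open>p > 2\<close>) auto
  then have J: "(?L t has_integral J t) {\<alpha>..\<beta>}" for t
    unfolding J_def by (intro integrable_integral integrable_continuous_interval)
  then have J_nonneg: "0 \<le> J t" for t
    by (rule has_integral_nonneg) (use ab in \<open>auto intro: energy_density_nonneg\<close>)
  have Ip: "Ip p (?F t) = C + ennreal (J t)" for t
  proof -
    let ?h = "\<lambda>r. ennreal (energy_density p r (?F t r) (?g t r)) * indicator {0<..} r"
    have h: "?h \<in> borel_measurable lebesgue"
      by (rule energy_density_measurable[OF F])
    have ind: "indicator {\<alpha>..\<beta>} \<in> borel_measurable (lebesgue :: real measure)"
      "indicator (- {\<alpha>..\<beta>}) \<in> borel_measurable (lebesgue :: real measure)"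
      by (rule borel_measurable_indicator; simp)+
    have "Ip p (?F t) = (\<integral>\<^sup>+r. ?h r * indicator (- {\<alpha>..\<beta>}) r + ?h r * indicator {\<alpha>..\<beta>} r \<partial>lebesgue)"
      unfolding pw_C1_Ip_density[OF F] by (intro nn_integral_cong) (simp add: indicator_def)
    also have "\<dots> = (\<integral>\<^sup>+r. ?h r * indicator (- {\<alpha>..\<beta>}) r \<partial>lebesgue) + (\<integral>\<^sup>+r. ?h r * indicator {\<alpha>..\<beta>} r \<partial>lebesgue)"
      by (intro nn_integral_add borel_measurable_times_ennreal h borel_measurable_indicator) simp_all
    also have "(\<integral>\<^sup>+r. ?h r * indicator (- {\<alpha>..\<beta>}) r \<partial>lebesgue) = C"
      unfolding C_def by (intro nn_integral_cong) (simp add: indicator_def)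
    also have "(\<integral>\<^sup>+r. ?h r * indicator {\<alpha>..\<beta>} r \<partial>lebesgue)
        = (\<integral>\<^sup>+r. ennreal (?L t r) * indicator {\<alpha>..\<beta>} r \<partial>lebesgue)"
      using ab by (intro nn_integral_cong) (simp add: indicator_def)
    also have "\<dots> = ennreal (J t)"
      unfolding nn_integral_completion
      by (rule nn_integral_has_integral_lebesgue'[OF _ J]) (use ab in \<open>auto intro: energy_density_nonneg\<close>)
    finally show ?thesis .
  qed
  have Ip0: "Ip p f = C + ennreal (J 0)"
    using Ip[of 0] by simp
  \<comment> \<open>Cancelling \<open>C\<close> in \<open>ennreal\<close> requires it to be finite;
    the competitor of finite energy ensures this.\<close>
  have "Ip p f < \<infinity>"
    using exists_finite_energy[OF \<open>p > 2\<close>] min unfolding minimizer_def by (meson le_less_trans)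
  then have C: "C < \<infinity>"
    by (simp add: Ip0)
  have J_min: "J 0 \<le> J t" for t
  proof -
    have "Ip p (?F t) < \<infinity>"
      using C by (simp add: Ip)
    then have "?F t \<in> Xp p"
      by (rule Xp_if_Ip_finite[OF F, rotated]) (use \<open>p > 2\<close> in simp)
    then have "Ip p f \<le> Ip p (?F t)"
      using min by (simp add: minimizer_def)
    then show ?thesis
      using C J_nonneg by (auto simp: Ip0 Ip ennreal_add_left_cancel_le)
  qed
  have "(J has_real_derivative integral (cbox \<alpha> \<beta>)
      (\<lambda>r. energy_variation p r (f r + 0 * \<phi> r) (f' r + 0 * \<psi> r) (\<phi> r) (\<psi> r))) (at 0 within UNIV)"
    unfolding J_def box_real[symmetric]
  proof (rule leibniz_rule_field_derivative)
    show "?L t integrable_on cbox \<alpha> \<beta>" for t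
      using J[of t] by auto
    have c: "continuous_on (UNIV \<times> {\<alpha>..\<beta>}) (\<lambda>z. h (snd z))" if "continuous_on {\<alpha>..\<beta>} h" for h :: "real \<Rightarrow> real"
      by (rule continuous_on_compose2[OF that]) (auto intro: continuous_intros)
    show "continuous_on (UNIV \<times> cbox \<alpha> \<beta>)
        (\<lambda>(t, r). energy_variation p r (f r + t * \<phi> r) (f' r + t * \<psi> r) (\<phi> r) (\<psi> r))"
      unfolding split_beta box_real using ab
      by (intro continuous_on_energy_variation continuous_intros c cf \<phi> \<psi> \<open>p > 2\<close>) auto
  qed (use DERIV_energy_density[OF \<open>p > 2\<close>] in auto)
  then have "(J has_real_derivative integral {\<alpha>..\<beta>}
      (\<lambda>r. energy_variation p r (f r) (f' r) (\<phi> r) (\<psi> r))) (at 0)"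
    by simp
  then show ?thesis
    by (rule DERIV_local_min[of _ _ _ 1]) (use J_min in auto)
qed

section \<open>The Euler--Lagrange equation\<close>

definition grad_weight :: "real \<Rightarrow> (real \<Rightarrow> real) \<Rightarrow> (real \<Rightarrow> real) \<Rightarrow> real \<Rightarrow> real" where
  "grad_weight p f f' r = ((f' r)\<^sup>2 + (f r)\<^sup>2 / r\<^sup>2) powr (p / 2 - 1)"

lemma continuous_on_grad_weight:
  assumes "p > 2" "continuous_on A f" "continuous_on A f'" "A \<subseteq> {0<..}"
  shows "continuous_on A (grad_weight p f f')"
  unfolding grad_weight_def[abs_def] using assms
  by (intro continuous_intros continuous_on_powr') auto

lemma DERIV_integral_interior:
  fixes h :: "real \<Rightarrow> real"
  assumes "continuous_on {\<alpha>..\<beta>} h" "\<alpha> < r" "r < \<beta>"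
  shows "((\<lambda>r. integral {\<alpha>..r} h) has_real_derivative h r) (at r)"
proof -
  have "((\<lambda>r. integral {\<alpha>..r} h) has_real_derivative h r) (at r within {\<alpha>..\<beta>})"
    using integral_has_real_derivative[OF assms(1)] assms by simp
  then show ?thesis
    using assms by (simp add: at_within_Icc_at)
qed

text \<open>With a primitive \<open>P\<close> of \<open>R\<close>, the weak equation says that W - P
  is orthogonal to every continuous \<psi> of mean zero. Testing with W - P - c itself gives W = P +
  c, so W inherits its derivative from P.\<close>

lemma du_Bois_Reymond:
  fixes W R :: "real \<Rightarrow> real"
  assumes ab: "\<alpha> < \<beta>"
    and W: "continuous_on {\<alpha>..\<beta>} W" and R: "continuous_on {\<alpha>..\<beta>} R"
    and weak: "\<And>\<phi> \<psi>. \<lbrakk>continuous_on {\<alpha>..\<beta>} \<phi>; \<phi> \<alpha> = 0; \<phi> \<beta> = 0; continuous_on {\<alpha>..\<beta>} \<psi>;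
        \<And>r. \<alpha> < r \<Longrightarrow> r < \<beta> \<Longrightarrow> (\<phi> has_real_derivative \<psi> r) (at r)\<rbrakk>
      \<Longrightarrow> integral {\<alpha>..\<beta>} (\<lambda>r. W r * \<psi> r + R r * \<phi> r) = 0"
    and r: "\<alpha> < r" "r < \<beta>"
  shows "(W has_real_derivative R r) (at r)"
proof -
  define P where "P r = integral {\<alpha>..r} R" for r
  have P: "continuous_on {\<alpha>..\<beta>} P"
    unfolding P_def[abs_def] by (intro indefinite_integral_continuous_1 integrable_continuous_interval R)
  \<comment> \<open>The mean value of W - P, which makes \<phi> vanish at \<beta>.\<close>
  define c where "c = integral {\<alpha>..\<beta>} (\<lambda>r. W r - P r) / (\<beta> - \<alpha>)"
  define \<psi> where "\<psi> r = W r - P r - c" for r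
  define \<phi> where "\<phi> r = integral {\<alpha>..r} \<psi>" for r
  have \<psi>: "continuous_on {\<alpha>..\<beta>} \<psi>"
    unfolding \<psi>_def[abs_def] by (intro continuous_intros W P)
  have \<phi>: "continuous_on {\<alpha>..\<beta>} \<phi>"
    unfolding \<phi>_def[abs_def] by (intro indefinite_integral_continuous_1 integrable_continuous_interval \<psi>)
  have d\<phi>: "(\<phi> has_real_derivative \<psi> r) (at r)" and dP: "(P has_real_derivative R r) (at r)"
    if "\<alpha> < r" "r < \<beta>" for r
    unfolding \<phi>_def[abs_def] P_def[abs_def] using that
    by (auto intro: DERIV_integral_interior[OF \<psi>] DERIV_integral_interior[OF R])
  have \<phi>0: "\<phi> \<alpha> = 0" by (simp add: \<phi>_def)
  have \<phi>1: "\<phi> \<beta> = 0"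
  proof -
    have "\<phi> \<beta> = integral {\<alpha>..\<beta>} (\<lambda>r. W r - P r) - integral {\<alpha>..\<beta>} (\<lambda>r. c)"
      unfolding \<phi>_def \<psi>_def[abs_def]
      by (intro Henstock_Kurzweil_Integration.integral_diff integrable_continuous_interval continuous_intros W P)
    then show ?thesis using ab by (simp add: c_def)
  qed
  have int: "(\<lambda>r. h r) integrable_on {\<alpha>..\<beta>}" if "continuous_on {\<alpha>..\<beta>} h" for h :: "real \<Rightarrow> real"
    using that by (rule integrable_continuous_interval)
  have "((\<lambda>r. W r * \<psi> r + R r * \<phi> r) has_integral 0) {\<alpha>..\<beta>}"
    using integrable_integral[OF int, of "\<lambda>r. W r * \<psi> r + R r * \<phi> r"] weak[OF \<phi> \<phi>0 \<phi>1 \<psi> d\<phi>]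
    by (simp add: continuous_intros W R \<phi> \<psi>)
  moreover have "((\<lambda>r. R r * \<phi> r + \<psi> r * P r) has_integral (P \<beta> * \<phi> \<beta> - P \<alpha> * \<phi> \<alpha>)) {\<alpha>..\<beta>}"
    by (rule fundamental_theorem_of_calculus_interior)
       (use ab dP d\<phi> in \<open>auto intro!: continuous_intros P \<phi> DERIV_mult
          simp flip: has_real_derivative_iff_has_vector_derivative\<close>)
  moreover have "((\<lambda>r. c * \<psi> r) has_integral (c * \<phi> \<beta>)) {\<alpha>..\<beta>}"
    unfolding \<phi>_def by (intro has_integral_mult_right integrable_integral int \<psi>)
  \<comment> \<open>The integral of \<psi> squared is the weak equation minus the integrated product
    rule for P \<phi> minus c times the integral of \<psi>; all three vanish.\<close>
  ultimately have "((\<lambda>r. (W r * \<psi> r + R r * \<phi> r) - (R r * \<phi> r + \<psi> r * P r) - c * \<psi> r) has_integral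
      0 - (P \<beta> * \<phi> \<beta> - P \<alpha> * \<phi> \<alpha>) - c * \<phi> \<beta>) {\<alpha>..\<beta>}"
    by (intro has_integral_diff)
  moreover have "(\<lambda>r. (W r * \<psi> r + R r * \<phi> r) - (R r * \<phi> r + \<psi> r * P r) - c * \<psi> r) = (\<lambda>r. (\<psi> r)\<^sup>2)"
    by (simp add: \<psi>_def power2_eq_square algebra_simps)
  ultimately have "((\<lambda>r. (\<psi> r)\<^sup>2) has_integral 0) (cbox \<alpha> \<beta>)"
    by (simp add: \<phi>0 \<phi>1)
  then have "(\<psi> r)\<^sup>2 = 0" if "r \<in> {\<alpha>..\<beta>}" for r
    by (rule has_integral_0_cbox_imp_0[rotated 2]) (use that ab \<psi> in \<open>auto intro!: continuous_intros\<close>)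
  then have "\<psi> r = 0" if "r \<in> {\<alpha>..\<beta>}" for r
    using that by simp
  then have W_eq: "P r + c = W r" if "r \<in> {\<alpha><..<\<beta>}" for r
    using that by (auto simp: \<psi>_def algebra_simps)
  have "((\<lambda>r. P r + c) has_real_derivative R r) (at r)"
    by (rule DERIV_cong[OF DERIV_add[OF dP[OF r] DERIV_const]]) simp
  then show ?thesis
    by (rule has_field_derivative_transform_within_open[where S = "{\<alpha><..<\<beta>}"]) (use r W_eq in auto)
qed

lemma euler_lagrange:
  assumes "p > 2" and min: "minimizer p f" and f: "pw_C1 f f'" and f': "continuous_on {0<..} f'" and "x > 0"
  shows "((\<lambda>r. r * grad_weight p f f' r * f' r) has_real_derivative
    grad_weight p f f' x * f x / x - 2 / p * x * f x * (1 - (f x)\<^sup>2)) (at x)"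
\<comment> \<open>Any compact interval in the half line with \<open>x\<close> in its interior would
  serve.\<close>
proof (rule du_Bois_Reymond[where \<alpha> = "x / 2" and \<beta> = "2 * x"
      and R = "\<lambda>x. grad_weight p f f' x * f x / x - 2 / p * x * f x * (1 - (f x)\<^sup>2)"])
  have sub: "{x / 2..2 * x} \<subseteq> {0<..}" using \<open>x > 0\<close> by auto
  then have c: "continuous_on {x / 2..2 * x} f" "continuous_on {x / 2..2 * x} f'"
    "continuous_on {x / 2..2 * x} (grad_weight p f f')"
    using f f' \<open>p > 2\<close> by (auto simp: pw_C1_def intro!: continuous_on_grad_weight intro: continuous_on_subset)
  show "continuous_on {x / 2..2 * x} (\<lambda>r. r * grad_weight p f f' r * f' r)"
    by (intro continuous_intros c)
  show "continuous_on {x / 2..2 * x} (\<lambda>x. grad_weight p f f' x * f x / x - 2 / p * x * f x * (1 - (f x)\<^sup>2))"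
    using sub by (intro continuous_intros c) auto
  fix \<phi> \<psi> :: "real \<Rightarrow> real"
  assume *: "continuous_on {x / 2..2 * x} \<phi>" "\<phi> (x / 2) = 0" "\<phi> (2 * x) = 0"
    "continuous_on {x / 2..2 * x} \<psi>"
    "\<And>r. x / 2 < r \<Longrightarrow> r < 2 * x \<Longrightarrow> (\<phi> has_real_derivative \<psi> r) (at r)"
  \<comment> \<open>The first variation is \<open>p\<close> times this expression; dividing by
    \<open>p\<close> leaves 2/p in front of the potential term.\<close>
  let ?h = "\<lambda>r. r * grad_weight p f f' r * f' r * \<psi> r
    + (grad_weight p f f' r * f r / r - 2 / p * r * f r * (1 - (f r)\<^sup>2)) * \<phi> r"
  have "integral {x / 2..2 * x} (\<lambda>r. energy_variation p r (f r) (f' r) (\<phi> r) (\<psi> r)) = 0"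
    by (rule first_variation) (use assms * in auto)
  also have "integral {x / 2..2 * x} (\<lambda>r. energy_variation p r (f r) (f' r) (\<phi> r) (\<psi> r))
    = integral {x / 2..2 * x} (\<lambda>r. p * ?h r)"
  proof (rule Henstock_Kurzweil_Integration.integral_cong)
    fix r assume "r \<in> {x / 2..2 * x}"
    then have "r > 0" using sub by auto
    then show "energy_variation p r (f r) (f' r) (\<phi> r) (\<psi> r) = p * ?h r"
      using \<open>p > 2\<close> by (simp add: energy_variation_def flip: grad_weight_def)
        (simp add: field_simps power2_eq_square)
  qed
  finally show "integral {x / 2..2 * x} ?h = 0"
    using \<open>p > 2\<close> by simp
qed (use \<open>x > 0\<close> in auto)

section \<open>Monotonicity of the profile\<close>

text \<open>Minimality survives in two consequences only: the equation \<open>ode\<close>, and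
  \<open>exceeds\<close>, which condenses finiteness of the energy into the statement that f does
  not stay at or below any c < 1 near infinity.\<close>

locale radial_profile =
  fixes p :: real and f f' :: "real \<Rightarrow> real"
  assumes p: "p > 2"
    and f0: "f 0 = 0" and cont_f: "continuous_on {0..} f"
    and nonneg: "r \<ge> 0 \<Longrightarrow> f r \<ge> 0"
    and DERIV_f: "r > 0 \<Longrightarrow> (f has_real_derivative f' r) (at r)"
    and f'_differentiable: "r > 0 \<Longrightarrow> f' differentiable at r"
    and ode: "r > 0 \<Longrightarrow> ((\<lambda>r. r * grad_weight p f f' r * f' r) has_real_derivative
      grad_weight p f f' r * f r / r - 2 / p * r * f r * (1 - (f r)\<^sup>2)) (at r)"
    and exceeds: "0 \<le> c \<Longrightarrow> c < 1 \<Longrightarrow> \<exists>r>a. f r > c"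
begin

abbreviation "G \<equiv> grad_weight p f f'"

definition "W r = r * G r * f' r"

definition "D r = G r - 2 / p * r\<^sup>2 * (1 - (f r)\<^sup>2)"

lemma DERIV_W: "r > 0 \<Longrightarrow> (W has_real_derivative f r / r * D r) (at r)"
  using ode[of r] unfolding W_def[abs_def] D_def
  by (rule DERIV_cong) (auto simp: field_simps power2_eq_square)

lemma continuous_on_f': "continuous_on {0<..} f'"
  using f'_differentiable
  by (auto simp: continuous_on_eq_continuous_at intro: differentiable_imp_continuous_within)

lemma continuous_on_D: "continuous_on {0<..} D"
  unfolding D_def[abs_def] using p
  by (intro continuous_intros continuous_on_grad_weight continuous_on_f' continuous_on_subset[OF cont_f]) auto

lemma W_zero: "f' r = 0 \<Longrightarrow> W r = 0"
  by (simp add: W_def)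

lemma G_pos:
  assumes "f' r \<noteq> 0"
  shows "G r > 0"
proof -
  have "(f' r)\<^sup>2 + (f r)\<^sup>2 / r\<^sup>2 > 0"
    using assms by (intro add_pos_nonneg) simp_all
  then show ?thesis by (simp add: grad_weight_def)
qed

lemma f'_pos_iff:
  assumes "r > 0"
  shows "f' r > 0 \<longleftrightarrow> W r > 0"
proof (cases "f' r = 0")
  case False
  then have "r * G r > 0" using assms G_pos by simp
  from mult_less_cancel_left_pos[OF this, of 0 "f' r"] show ?thesis by (simp add: W_def)
qed (simp add: W_zero)

lemma f'_neg_iff:
  assumes "r > 0"
  shows "f' r < 0 \<longleftrightarrow> W r < 0"
proof (cases "f' r = 0")
  case False
  then have "r * G r > 0" using assms G_pos by simp
  from mult_less_cancel_left_pos[OF this, of "f' r" 0] show ?thesis by (simp add: W_def)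
qed (simp add: W_zero)

section \<open>Positivity of the profile\<close>

lemma critical_if_zero:
  assumes "r > 0" "f r = 0"
  shows "f' r = 0"
  using DERIV_f[OF \<open>r > 0\<close>] \<open>r > 0\<close>
  by (rule DERIV_local_min) (use assms in \<open>auto intro: nonneg\<close>)

lemma locally_zero:
  assumes r: "r > 0" "f r = 0"
  shows "\<exists>e>0. e \<le> r \<and> (\<forall>s. \<bar>s - r\<bar> < e \<longrightarrow> f s = 0)"
proof -
  have "G r = 0"
    using r critical_if_zero[OF r] by (simp add: grad_weight_def)
  then have "D r < 0"
    using r p by (simp add: D_def)
  have "isCont D r"
    using continuous_on_D r by (simp add: continuous_on_eq_continuous_at)
  then have "eventually (\<lambda>s. D s < 0) (at r)"
    using \<open>D r < 0\<close> by (simp add: isCont_def order_tendsto_iff)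
  then obtain e where e: "e > 0" "\<And>s. \<bar>s - r\<bar> < e \<Longrightarrow> D s < 0"
    using \<open>D r < 0\<close> unfolding eventually_at dist_real_def by (metis UNIV_I)
  \<comment> \<open>The bound by \<open>r\<close> keeps the neighbourhood inside the half line,
    where the equation holds.\<close>
  define d where "d = min e r"
  have D_neg: "s > 0 \<and> D s < 0" if "\<bar>s - r\<bar> < d" for s
    using that e unfolding d_def by auto
  have W_dec: "W t \<le> W s" if "\<bar>s - r\<bar> < d" "\<bar>t - r\<bar> < d" "s \<le> t" for s t
  proof (rule DERIV_nonpos_imp_nonincreasing[OF \<open>s \<le> t\<close>])
    fix u assume "s \<le> u" "u \<le> t"
    then have "\<bar>u - r\<bar> < d" using that by linarith
    from D_neg[OF this] have "f u / u * D u \<le> 0" "u > 0"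
      using nonneg[of u] by (auto intro!: mult_nonneg_nonpos simp del: times_divide_eq_left)
    then show "\<exists>y. (W has_real_derivative y) (at u) \<and> y \<le> 0"
      using DERIV_W[of u] by blast
  qed
  have "W r = 0" using critical_if_zero[OF r] by (rule W_zero)
  \<comment> \<open>W, and with it f', is non-negative to the left of \<open>r\<close> and
    non-positive to the right, so f is largest at \<open>r\<close>, where it is 0.\<close>
  have "f s = 0" if s: "\<bar>s - r\<bar> < d" for s
  proof (cases "s \<ge> r")
    case True
    have "f s \<le> f r"
    proof (rule DERIV_nonpos_imp_nonincreasing[OF True])
      fix u assume u: "r \<le> u" "u \<le> s"
      then have "\<bar>u - r\<bar> < d" using s by linarith
      then have "u > 0" "W u \<le> 0" using D_neg[of u] W_dec[of r u] u \<open>W r = 0\<close> s by auto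
      then show "\<exists>y. (f has_real_derivative y) (at u) \<and> y \<le> 0"
        using DERIV_f[of u] f'_pos_iff[of u] by (metis not_less)
    qed
    then show ?thesis using r nonneg[of s] True by simp
  next
    case False
    have "f s \<le> f r"
    proof (rule DERIV_nonneg_imp_nondecreasing[where f = f])
      fix u assume u: "s \<le> u" "u \<le> r"
      then have "\<bar>u - r\<bar> < d" using s by linarith
      then have "u > 0" "W u \<ge> 0" using D_neg[of u] W_dec[of u r] u \<open>W r = 0\<close> s by auto
      then show "\<exists>y. (f has_real_derivative y) (at u) \<and> 0 \<le> y"
        using DERIV_f[of u] f'_neg_iff[of u] by (metis not_less)
    qed (use False in simp)
    then show ?thesis using r nonneg[of s] D_neg[OF s] by simp
  qed
  then show ?thesis
    using e r by (intro exI[of _ d]) (auto simp: d_def)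
qed

lemma f_pos:
  assumes "r > 0"
  shows "f r > 0"
proof (rule ccontr)
  assume "\<not> f r > 0"
  then have r: "f r = 0" using nonneg[of r] assms by simp
  let ?Z = "{s \<in> {0<..}. f s = 0}"
  have "open ?Z"
    unfolding open_dist
  proof
    fix s assume "s \<in> ?Z"
    then obtain e where "e > 0" "e \<le> s" "\<forall>t. \<bar>t - s\<bar> < e \<longrightarrow> f t = 0"
      using locally_zero[of s] by auto
    then show "\<exists>e>0. \<forall>t. dist t s < e \<longrightarrow> t \<in> ?Z"
      by (intro exI[of _ e]) (auto simp: dist_real_def)
  qed
  then have "openin (top_of_set {0<..}) ?Z"
    by (intro open_openin_trans) auto
  moreover have "closedin (top_of_set {0<..}) ?Z"
    by (intro continuous_closedin_preimage_constant continuous_on_subset[OF cont_f]) auto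
  ultimately have "?Z = {} \<or> ?Z = {0<..}"
    using connected_Ioi[of "0::real"] unfolding connected_clopen by blast
  then have "f s = 0" if "s > 0" for s
    using r assms that by blast
  then show False
    using exceeds[of 0 1] by force
qed

section \<open>Behaviour next to critical points\<close>

lemma critical_rising:
  assumes "r > 0" "f' r = 0" "D r > 0"
  shows "\<exists>d>0. \<forall>h>0. h < d \<longrightarrow> f' (r + h) > 0 \<and> f' (r - h) < 0"
proof -
  \<comment> \<open>This is the derivative of W at its zero \<open>r\<close>. Since W has the sign
    of f', it stands in for the second derivative of f.\<close>
  have pos: "f r / r * D r > 0"
    using assms f_pos by simp
  obtain d where d: "d > 0" "\<forall>h>0. h < d \<longrightarrow> W r < W (r + h)"
    using DERIV_pos_inc_right[OF DERIV_W pos] assms by blast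
  obtain e where e: "e > 0" "\<forall>h>0. h < e \<longrightarrow> W (r - h) < W r"
    using DERIV_pos_inc_left[OF DERIV_W pos] assms by blast
  show ?thesis
    using d e assms W_zero[of r] f'_pos_iff f'_neg_iff
    by (intro exI[of _ "min (min d e) r"]) auto
qed

lemma critical_falling:
  assumes "r > 0" "f' r = 0" "D r < 0"
  shows "\<exists>d>0. \<forall>h>0. h < d \<longrightarrow> f' (r + h) < 0"
proof -
  have neg: "f r / r * D r < 0"
    using assms f_pos by (intro mult_pos_neg) simp_all
  obtain d where d: "d > 0" "\<forall>h>0. h < d \<longrightarrow> W (r + h) < W r"
    using DERIV_neg_dec_right[OF DERIV_W neg] assms by blast
  then show ?thesis
    using assms W_zero[of r] f'_neg_iff by (intro exI[of _ d]) auto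
qed

text \<open>The second-order condition at a maximum, in one-sided form: D r > 0 would make f
  strictly increase immediately to the right.\<close>

lemma max_imp_D_nonpos:
  assumes "0 < r" "f' r = 0" "r < b" and max: "\<And>s. r \<le> s \<Longrightarrow> s \<le> b \<Longrightarrow> f s \<le> f r"
  shows "D r \<le> 0"
proof (rule ccontr)
  assume "\<not> D r \<le> 0"
  then obtain d where d: "d > 0" "\<And>h. 0 < h \<Longrightarrow> h < d \<Longrightarrow> f' (r + h) > 0"
    using critical_rising[of r] assms by auto
  define s where "s = r + min (d / 2) (b - r)"
  have s: "r < s" "s \<le> b" "s < r + d" using d assms by (auto simp: s_def)
  have "f r < f s"
  proof (rule DERIV_pos_imp_increasing_open[OF \<open>r < s\<close>])
    show "\<exists>y. (f has_real_derivative y) (at u) \<and> 0 < y" if "r < u" "u < s" for u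
      using that s d(2)[of "u - r"] DERIV_f[of u] \<open>0 < r\<close> by auto
    show "continuous_on {r..s} f"
      using \<open>0 < r\<close> by (intro continuous_on_subset[OF cont_f]) auto
  qed
  then show False using max[of s] s by simp
qed

lemma min_imp_D_nonneg:
  assumes "0 < r" "f' r = 0" "r < b" and min: "\<And>s. r \<le> s \<Longrightarrow> s \<le> b \<Longrightarrow> f r \<le> f s"
  shows "D r \<ge> 0"
proof (rule ccontr)
  assume "\<not> D r \<ge> 0"
  then obtain d where d: "d > 0" "\<And>h. 0 < h \<Longrightarrow> h < d \<Longrightarrow> f' (r + h) < 0"
    using critical_falling[of r] assms by auto
  define s where "s = r + min (d / 2) (b - r)"
  have s: "r < s" "s \<le> b" "s < r + d" using d assms by (auto simp: s_def)
  have "f s < f r"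
  proof (rule DERIV_neg_imp_decreasing_open[OF \<open>r < s\<close>])
    show "\<exists>y. (f has_real_derivative y) (at u) \<and> y < 0" if "r < u" "u < s" for u
      using that s d(2)[of "u - r"] DERIV_f[of u] \<open>0 < r\<close> by auto
    show "continuous_on {r..s} f"
      using \<open>0 < r\<close> by (intro continuous_on_subset[OF cont_f]) auto
  qed
  then show False using min[of s] s by simp
qed

text \<open>At a critical point the weight depends on \<open>f r / r\<close> alone, and
  monotonically; this makes the signs of D at two critical points comparable.\<close>

lemma G_critical:
  assumes "r > 0" "f' r = 0"
  shows "G r = (f r / r) powr (p - 2)"
proof -
  have "(f r)\<^sup>2 / r\<^sup>2 = (f r / r) powr 2"
    using assms f_pos[of r] by (simp add: power_divide)
  then show ?thesis
    using assms by (simp add: grad_weight_def powr_powr right_diff_distrib)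
qed

section \<open>Monotonicity and its strictness\<close>

lemma f'_nonneg:
  assumes "a > 0"
  shows "f' a \<ge> 0"
proof (rule ccontr)
  assume neg: "\<not> f' a \<ge> 0"
  have cont: "continuous_on {x..y} f" if "x \<ge> 0" for x y
    using that by (intro continuous_on_subset[OF cont_f]) auto
  \<comment> \<open>The maximum is interior: f is larger just to the left of \<open>a\<close> than
    at \<open>a\<close>, and it vanishes at 0.\<close>
  obtain r1 where r1: "r1 \<in> {0..a}" "\<And>s. s \<in> {0..a} \<Longrightarrow> f s \<le> f r1"
    using continuous_attains_sup[OF compact_Icc _ cont[of 0 a]] assms by auto
  obtain d where d: "d > 0" "\<And>h. 0 < h \<Longrightarrow> h < d \<Longrightarrow> f a < f (a - h)"
    using DERIV_neg_dec_left[OF DERIV_f[OF assms]] neg by auto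
  have "f a < f (a - min (d / 2) a)"
    using d assms by simp
  also have "\<dots> \<le> f r1"
    using d assms by (intro r1) auto
  finally have fa: "f a < f r1" .
  then have r1_less: "0 < r1" "r1 < a"
    using r1(1) nonneg[of a] assms f0 by (auto simp: less_le)
  have crit1: "f' r1 = 0"
    by (rule DERIV_local_max[OF DERIV_f, of _ "min r1 (a - r1)"])
       (use r1_less r1(2) in \<open>auto simp: abs_less_iff\<close>)
  have "D r1 \<le> 0"
    by (rule max_imp_D_nonpos[OF _ crit1, of a]) (use r1_less r1 in auto)
  then have D1: "(f r1 / r1) powr (p - 2) \<le> 2 / p * r1\<^sup>2 * (1 - (f r1)\<^sup>2)"
    using G_critical[OF _ crit1] r1_less by (simp add: D_def)
  \<comment> \<open>A positive left side forces f r1 < 1, which is the condition for applying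
    \<open>exceeds\<close>.\<close>
  moreover have "0 < (f r1 / r1) powr (p - 2)"
    using f_pos[of r1] r1_less by simp
  ultimately have "0 < 2 / p * r1\<^sup>2 * (1 - (f r1)\<^sup>2)" by linarith
  then have "0 < 1 - (f r1)\<^sup>2"
    by (rule zero_less_mult_pos) (use p r1_less in simp)
  then have "(f r1)\<^sup>2 < 1" by simp
  then have "\<bar>f r1\<bar> < 1" by (simp add: abs_square_less_1)
  then have "f r1 < 1" by linarith
  then obtain b where b: "b > a" "f b > f r1"
    using exceeds[of "f r1" a] nonneg[of r1] r1_less by auto
  \<comment> \<open>The minimum is interior because f a lies below the values at both ends, f r1 and
    f b.\<close>
  obtain r2 where r2: "r2 \<in> {r1..b}" "\<And>s. s \<in> {r1..b} \<Longrightarrow> f r2 \<le> f s"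
    using continuous_attains_inf[OF compact_Icc _ cont[of r1 b]] b r1_less by auto
  have "f r2 \<le> f a" using r2(2)[of a] r1_less b by simp
  with fa have f21: "f r2 < f r1" by simp
  then have r2_less: "r1 < r2" "r2 < b"
    using r2(1) b by (auto simp: less_le)
  have crit2: "f' r2 = 0"
    by (rule DERIV_local_min[OF DERIV_f, of _ "min (r2 - r1) (b - r2)"])
       (use r1_less r2_less r2(2) in \<open>auto simp: abs_less_iff\<close>)
  have "D r2 \<ge> 0"
    by (rule min_imp_D_nonneg[OF _ crit2, of b]) (use r1_less r2_less r2 in auto)
  then have D2: "2 / p * r2\<^sup>2 * (1 - (f r2)\<^sup>2) \<le> (f r2 / r2) powr (p - 2)"
    using G_critical[OF _ crit2] r1_less r2_less by (simp add: D_def)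
  \<comment> \<open>From r1 to r2 the value of f drops and the radius grows. So f/r decreases, while
    r^2 (1 - f^2) does not; \<open>D1\<close> and \<open>D2\<close> close this chain into a strict
    cycle.\<close>
  have "(f r2 / r2) powr (p - 2) < (f r1 / r1) powr (p - 2)"
    using p f21 r1_less r2_less f_pos[of r2]
    by (intro powr_less_mono2 frac_less) auto
  also note D1
  also have "2 / p * r1\<^sup>2 * (1 - (f r1)\<^sup>2) \<le> 2 / p * r2\<^sup>2 * (1 - (f r2)\<^sup>2)"
    using p r1_less r2_less \<open>(f r1)\<^sup>2 < 1\<close> f21 f_pos[of r2]
    by (intro mult_mono power_mono diff_left_mono mult_left_mono) auto
  also note D2
  finally show False by simp
qed

lemma f'_pos:
  assumes "a > 0"
  shows "f' a > 0"
proof (rule ccontr)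
  assume "\<not> f' a > 0"
  then have crit: "f' a = 0" using f'_nonneg[OF assms] by simp
  consider "D a > 0" | "D a < 0" | "D a = 0" by linarith
  then show False
  proof cases
    case 1
    then obtain d where d: "d > 0" "\<forall>h>0. h < d \<longrightarrow> f' (a - h) < 0"
      using critical_rising[OF assms crit] by blast
    define h where "h = min (d / 2) (a / 2)"
    have "0 < h" "h < d" "h < a" using d assms by (auto simp: h_def)
    then show False using d f'_nonneg[of "a - h"] by fastforce
  next
    case 2
    then obtain d where d: "d > 0" "\<forall>h>0. h < d \<longrightarrow> f' (a + h) < 0"
      using critical_falling[OF assms crit] by blast
    then have "f' (a + d / 2) < 0" using d(2)[rule_format, of "d / 2"] by simp
    then show False using f'_nonneg[of "a + d / 2"] assms d(1) by simp
  next
    case 3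
    \<comment> \<open>Here the derivative of W at \<open>a\<close> vanishes as well, so the sign has
      to come from the derivative of D.\<close>
    have fa: "f a > 0" using assms by (rule f_pos)
    obtain f'' where f'': "(f' has_real_derivative f'') (at a)"
      using f'_differentiable[OF assms] real_differentiable_def by blast
    let ?q = "\<lambda>r. (f' r)\<^sup>2 + (f r)\<^sup>2 / r\<^sup>2"
    \<comment> \<open>Positivity of the base makes the power differentiable at \<open>a\<close> even
      when p/2 - 1 is below 1.\<close>
    have q: "?q a > 0" using fa assms crit by simp
    \<comment> \<open>Since f' a = 0, the term with \<open>f''\<close> and the derivative of the
      numerator \<open>(f r)\<^sup>2\<close> drop out; only the factor 1/r^2 contributes.\<close>
    have "(?q has_real_derivative - (2 * (f a)\<^sup>2 / a ^ 3)) (at a)"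
      using assms crit
      by (auto intro!: derivative_eq_intros f'' DERIV_f simp: field_simps power2_eq_square power3_eq_cube)
    from DERIV_chain2[where f = "\<lambda>x. x powr (p / 2 - 1)" and g = ?q, OF has_real_derivative_powr[OF q] this]
    have dG: "(G has_real_derivative
        (p / 2 - 1) * ?q a powr (p / 2 - 1 - 1) * - (2 * (f a)\<^sup>2 / a ^ 3)) (at a)" (is "(_ has_real_derivative ?G') _")
      by (simp add: grad_weight_def[abs_def])
    have "((\<lambda>r. 2 / p * r\<^sup>2 * (1 - (f r)\<^sup>2)) has_real_derivative 2 / p * (2 * a) * (1 - (f a)\<^sup>2)) (at a)"
      using assms crit p by (auto intro!: derivative_eq_intros DERIV_f simp: field_simps)
    from DERIV_diff[OF dG this]
    have dD: "(D has_real_derivative ?G' - 2 / p * (2 * a) * (1 - (f a)\<^sup>2)) (at a)"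
      by (simp add: D_def[abs_def])
    have "?G' < 0"
      using p q fa assms by (intro mult_pos_neg mult_pos_pos) auto
    \<comment> \<open>D a = 0 equates the potential part of D with G a > 0, so the second term of
      the derivative of D pushes downwards too.\<close>
    moreover have "1 - (f a)\<^sup>2 > 0"
    proof -
      have "0 < G a" using q by (simp add: grad_weight_def)
      then have "0 < 2 / p * a\<^sup>2 * (1 - (f a)\<^sup>2)"
        using 3 by (simp add: D_def)
      then show ?thesis
        by (rule zero_less_mult_pos) (use p assms in simp)
    qed
    then have "2 / p * (2 * a) * (1 - (f a)\<^sup>2) > 0"
      using p assms by simp
    ultimately have "?G' - 2 / p * (2 * a) * (1 - (f a)\<^sup>2) < 0" by linarith
    from DERIV_neg_dec_right[OF dD this]
    obtain d where d: "d > 0" "\<And>h. 0 < h \<Longrightarrow> h < d \<Longrightarrow> D (a + h) < 0"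
      using 3 by auto
    \<comment> \<open>The derivative of W is 0 at \<open>a\<close> itself but negative on the open
      interval, which suffices for strict decrease.\<close>
    have "W (a + d / 2) < W a"
    proof (rule DERIV_neg_imp_decreasing_open[where f = W])
      show "\<exists>y. (W has_real_derivative y) (at u) \<and> y < 0" if "a < u" "u < a + d / 2" for u
      proof -
        have "D u < 0" "u > 0" using d(2)[of "u - a"] that assms by auto
        moreover from this have "f u / u * D u < 0"
          using f_pos[of u] by (intro mult_pos_neg) simp_all
        ultimately show ?thesis
          using DERIV_W[of u] by blast
      qed
      show "continuous_on {a..a + d / 2} W"
        using assms DERIV_W by (intro DERIV_continuous_on[of _ W "\<lambda>r. f r / r * D r"])
          (auto intro: has_field_derivative_at_within)
    qed (use d in simp)
    then have "f' (a + d / 2) < 0"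
      using f'_neg_iff[of "a + d / 2"] W_zero[OF crit] assms d by simp
    then show False using f'_nonneg[of "a + d / 2"] assms d by simp
  qed
qed

end

section \<open>From finite energy to the theorem\<close>

lemma Ip_finite_imp_exceeds:
  assumes f: "pw_C1 f f'" and fin: "Ip p f < \<infinity>" and c: "0 \<le> c" "c < 1"
    and nonneg: "\<And>r. r \<ge> 0 \<Longrightarrow> f r \<ge> 0"
  shows "\<exists>r>a. f r > c"
proof (rule ccontr)
  assume "\<not> (\<exists>r>a. f r > c)"
  then have le: "f r \<le> c" if "r > a" for r using that by (meson not_less)
  define b where "b = max a 1"
  \<comment> \<open>The potential at height \<open>c\<close>: as long as 0 \<le> f \<le> c < 1 it
    bounds the density from below by a positive constant, on a half line of infinite
    measure.\<close>
  define m where "m = 1 / 2 * (1 - c\<^sup>2)\<^sup>2"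
  have "c\<^sup>2 < 1" using c by (simp add: power_less_one_iff abs_square_less_1)
  then have "m > 0" by (simp add: m_def)
  have "m \<le> energy_density p r (f r) (f' r)" if "r > b" for r
  proof -
    have r: "r > a" "r > 1" using that by (auto simp: b_def)
    have "(f r)\<^sup>2 \<le> c\<^sup>2"
      using le[OF r(1)] nonneg[of r] r by (intro power_mono) auto
    then have "(1 - c\<^sup>2)\<^sup>2 \<le> (1 - (f r)\<^sup>2)\<^sup>2"
      using \<open>c\<^sup>2 < 1\<close> by (intro power_mono) auto
    then have "m \<le> (((f' r)\<^sup>2 + (f r)\<^sup>2 / r\<^sup>2) powr (p / 2) + 1 / 2 * (1 - (f r)\<^sup>2)\<^sup>2) * 1"
      unfolding m_def by (simp add: add_increasing)
    also have "\<dots> \<le> energy_density p r (f r) (f' r)"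
      unfolding energy_density_def using r by (intro mult_left_mono) auto
    finally show ?thesis .
  qed
  then have le_Ip: "(\<integral>\<^sup>+r. ennreal m * indicator {b<..} r \<partial>lebesgue) \<le> Ip p f"
    unfolding pw_C1_Ip_density[OF f]
    by (intro nn_integral_mono) (auto simp: indicator_def b_def intro!: ennreal_leI)
  have inf: "(\<integral>\<^sup>+r. ennreal m * indicator {b<..} r \<partial>lebesgue) = \<infinity>"
  proof -
    have "emeasure lborel {b<..} = \<infinity>"
    proof (rule ccontr)
      assume "emeasure lborel {b<..} \<noteq> \<infinity>"
      then obtain y where y: "y \<ge> 0" "emeasure lborel {b<..} = ennreal y"
        by (cases "emeasure lborel {b<..}") auto
      obtain n where n: "y < real n" using reals_Archimedean2 by blast
      have "emeasure lborel {b<..b + real n} \<le> emeasure lborel {b<..}"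
        by (rule emeasure_mono) auto
      then show False using y n by simp
    qed
    then show ?thesis
      using \<open>m > 0\<close> unfolding nn_integral_completion
      by (simp add: nn_integral_cmult_indicator ennreal_mult_top)
  qed
  show False
    using le_less_trans[OF le_Ip fin] unfolding inf by simp
qed

theorem proposition2p5:
  fixes p :: real and f :: "real \<Rightarrow> real"
  assumes "p > 2"
    and "minimizer p f"
    and "\<forall>r\<ge>0. f r \<ge> 0"
    and "continuous_on {0..} f" and "f 0 = 0"
    and "smooth_on {0<..} f"
  shows "\<forall>r\<in>{0<..}. deriv f r > 0"
proof -
  have smooth: "(deriv ^^ n) f differentiable (at r)" if "r > 0" for n r
  proof -
    have "(deriv ^^ n) f differentiable (at r within {0<..})"
      using assms(6) that by (auto simp: smooth_on_def differentiable_on_def)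
    then show ?thesis using that by (simp add: at_within_open[of r "{0<..}"])
  qed
  have df: "(f has_real_derivative deriv f r) (at r)" if "r > 0" for r
    using smooth[OF that, of 0] by (simp add: DERIV_deriv_iff_real_differentiable)
  have ddf: "deriv f differentiable (at r)" if "r > 0" for r
    using smooth[OF that, of 1] by simp
  have cont: "continuous_on {0<..} (deriv f)"
    using ddf by (auto simp: continuous_on_eq_continuous_at intro: differentiable_imp_continuous_within)
  have f: "pw_C1 f (deriv f)"
    unfolding pw_C1_def
    using df loc_bounded_continuous[OF cont] continuous_on_subset[OF assms(4), of "{0<..}"]
    by (auto simp: subset_iff)
  have "Ip p f < \<infinity>"
    using exists_finite_energy[OF \<open>p > 2\<close>] assms(2) unfolding minimizer_def by (meson le_less_trans)
  then interpret radial_profile p f "deriv f"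
    using assms df ddf euler_lagrange[OF assms(1,2) f cont] Ip_finite_imp_exceeds[OF f]
    by unfold_locales auto
  show ?thesis using f'_pos by auto
qed

end
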